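(* Assume the Continuum Hypothesis fails. Then for every valuation domain $R$ of cardinality $\aleph_1$ and every type $J/R$ such that $\Gamma(J/R)\neq 0$, there is a non-standard uniserial $R$-module of type $J/R$.
   Context: A valuation domain is an integral domain whose ideals are linearly ordered; $Q$ its quotient field. A module is uniserial if its submodules are linearly ordered; a uniserial $R$-module is standard if isomorphic to $J'/A$ for $R$-submodules $A\subseteq J'$ of $Q$, non-standard otherwise. For uniserial $U$ and $0\neq a\in U$, $\mathrm{Ann}(a)=\{r:ra=0\}$, $D(a)=\bigcup\{r^{-1}R:a\in rU\}$; $U$ has type $J/A$ if $J/A\cong D(a)/\mathrm{Ann}(a)$. A type $J/R$ is given by an $R$-submodule $J$ of $Q$ with $R\subseteq J$; write $J=\bigcup_{\sigma<\omega_1} r_\sigma^{-1}R$ with nonzero $r_\sigma\in R$, $r_\tau\mid r_\sigma$ for $\tau<\sigma$. A cub is a closed unbounded subset of $\omega_1$; $D(\omega_1)$ is ${\cal P}(\omega_1)$ modulo $S_1\sim S_2$ iff $S_1\cap C=S_2\cap C$ for some cub $C$, a Boolean algebra whose $0$ is the class of sets disjoint from a cub and whose $1$ is the class of sets containing a cub. $\Gamma(J/R)$ is the class of $S=\{\delta<\omega_1\text{ limit}: R/\bigcap_{\sigma<\delta}r_\sigma R\text{ is not complete}\}$, where $R/\bigcap_{\sigma<\delta}r_\sigma R$ carries the metrizable linear topology with basis of neighbourhoods of $0$ given by the images of $r_\sigma R$, $\sigma<\delta$. This is independent of the choice of the $r_\sigma$. *)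

theory Defs
  imports Complex_Main "HOL-Computational_Algebra.Fraction_Field"
    "HOL-Library.Equipollence" "HOL-Library.Countable_Set"
begin

definition is_ideal :: "'r::idom set \<Rightarrow> bool" where
  "is_ideal I \<longleftrightarrow> 0 \<in> I \<and> (\<forall>x\<in>I. \<forall>y\<in>I. x + y \<in> I) \<and> (\<forall>r. \<forall>x\<in>I. r * x \<in> I)"

definition valuation_domain :: "'r::idom itself \<Rightarrow> bool" where
  "valuation_domain _ \<longleftrightarrow>
     (\<forall>I J :: 'r set. is_ideal I \<and> is_ideal J \<longrightarrow> I \<subseteq> J \<or> J \<subseteq> I)"

definition emb :: "'r::idom \<Rightarrow> 'r fract" where
  "emb r = Fraction_Field.Fract r 1"

definition Rset :: "'r::idom fract set" where
  "Rset = range emb"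

definition invR :: "'r::idom \<Rightarrow> 'r fract set" where
  "invR r = {Fraction_Field.Fract s r | s. True}"

definition Q_submodule :: "'r::idom fract set \<Rightarrow> bool" where
  "Q_submodule S \<longleftrightarrow> 0 \<in> S \<and> (\<forall>x\<in>S. \<forall>y\<in>S. x + y \<in> S)
      \<and> (\<forall>r. \<forall>x\<in>S. emb r * x \<in> S)"

text \<open>X/Y isomorphic to X'/Y' (Y a submodule of X, Y' of X', all in Q):
  there is an R-homomorphism from X onto X'/Y' with kernel Y,
  given by a map of representatives.\<close>
definition quot_iso :: "'r::idom fract set \<Rightarrow> 'r fract set \<Rightarrow> 'r fract set \<Rightarrow> 'r fract set \<Rightarrow> bool" where
  "quot_iso X Y X' Y' \<longleftrightarrow> (\<exists>f.
      (\<forall>x\<in>X. f x \<in> X')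
    \<and> (\<forall>x\<in>X. \<forall>y\<in>X. f (x + y) - (f x + f y) \<in> Y')
    \<and> (\<forall>r. \<forall>x\<in>X. f (emb r * x) - emb r * f x \<in> Y')
    \<and> (\<forall>x\<in>X. f x \<in> Y' \<longleftrightarrow> x \<in> Y)
    \<and> (\<forall>x'\<in>X'. \<exists>x\<in>X. f x - x' \<in> Y'))"

definition is_module :: "'m set \<Rightarrow> ('m \<Rightarrow> 'm \<Rightarrow> 'm) \<Rightarrow> 'm \<Rightarrow> ('r::idom \<Rightarrow> 'm \<Rightarrow> 'm) \<Rightarrow> bool" where
  "is_module M add z sm \<longleftrightarrow>
      z \<in> M \<and> (\<forall>x\<in>M. \<forall>y\<in>M. add x y \<in> M) \<and> (\<forall>r. \<forall>x\<in>M. sm r x \<in> M)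
    \<and> (\<forall>x\<in>M. \<forall>y\<in>M. \<forall>w\<in>M. add (add x y) w = add x (add y w))
    \<and> (\<forall>x\<in>M. \<forall>y\<in>M. add x y = add y x)
    \<and> (\<forall>x\<in>M. add z x = x)
    \<and> (\<forall>x\<in>M. \<exists>y\<in>M. add x y = z)
    \<and> (\<forall>r. \<forall>x\<in>M. \<forall>y\<in>M. sm r (add x y) = add (sm r x) (sm r y))
    \<and> (\<forall>r s. \<forall>x\<in>M. sm (r + s) x = add (sm r x) (sm s x))
    \<and> (\<forall>r s. \<forall>x\<in>M. sm (r * s) x = sm r (sm s x))
    \<and> (\<forall>x\<in>M. sm 1 x = x)"

definition submodule :: "'m set \<Rightarrow> 'm set \<Rightarrow> ('m \<Rightarrow> 'm \<Rightarrow> 'm) \<Rightarrow> 'm \<Rightarrow> ('r::idom \<Rightarrow> 'm \<Rightarrow> 'm) \<Rightarrow> bool" where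
  "submodule N M add z sm \<longleftrightarrow> N \<subseteq> M \<and> z \<in> N \<and> (\<forall>x\<in>N. \<forall>y\<in>N. add x y \<in> N)
      \<and> (\<forall>r. \<forall>x\<in>N. sm r x \<in> N)"

definition uniserial :: "'m set \<Rightarrow> ('m \<Rightarrow> 'm \<Rightarrow> 'm) \<Rightarrow> 'm \<Rightarrow> ('r::idom \<Rightarrow> 'm \<Rightarrow> 'm) \<Rightarrow> bool" where
  "uniserial M add z sm \<longleftrightarrow> is_module M add z sm \<and>
     (\<forall>N1 N2. submodule N1 M add z sm \<and> submodule N2 M add z sm \<longrightarrow> N1 \<subseteq> N2 \<or> N2 \<subseteq> N1)"

text \<open>standard: isomorphic to J'/A for R-submodules A \<subseteq> J' of Q, i.e. there is a
  surjective R-homomorphism J' \<rightarrow> M with kernel A.\<close>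
definition standard :: "'m set \<Rightarrow> ('m \<Rightarrow> 'm \<Rightarrow> 'm) \<Rightarrow> 'm \<Rightarrow> ('r::idom \<Rightarrow> 'm \<Rightarrow> 'm) \<Rightarrow> bool" where
  "standard M add z sm \<longleftrightarrow> (\<exists>J' A (f :: 'r fract \<Rightarrow> 'm).
      Q_submodule J' \<and> Q_submodule A \<and> A \<subseteq> J'
    \<and> (\<forall>x\<in>J'. f x \<in> M)
    \<and> (\<forall>x\<in>J'. \<forall>y\<in>J'. f (x + y) = add (f x) (f y))
    \<and> (\<forall>r. \<forall>x\<in>J'. f (emb r * x) = sm r (f x))
    \<and> f ` J' = M
    \<and> (\<forall>x\<in>J'. f x = z \<longleftrightarrow> x \<in> A))"

definition Ann :: "'m set \<Rightarrow> 'm \<Rightarrow> ('r::idom \<Rightarrow> 'm \<Rightarrow> 'm) \<Rightarrow> 'm \<Rightarrow> 'r set" where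
  "Ann M z sm a = {r. sm r a = z}"

definition Dset :: "'m set \<Rightarrow> ('r::idom \<Rightarrow> 'm \<Rightarrow> 'm) \<Rightarrow> 'm \<Rightarrow> 'r fract set" where
  "Dset M sm a = \<Union> {invR r | r. r \<noteq> 0 \<and> (\<exists>u\<in>M. a = sm r u)}"

text \<open>U has type J/A: J/A is isomorphic to D(a)/Ann(a) (for every nonzero a; this
  is independent of a).\<close>
definition has_type :: "'m set \<Rightarrow> ('m \<Rightarrow> 'm \<Rightarrow> 'm) \<Rightarrow> 'm \<Rightarrow> ('r::idom \<Rightarrow> 'm \<Rightarrow> 'm)
     \<Rightarrow> 'r fract set \<Rightarrow> 'r fract set \<Rightarrow> bool" where
  "has_type M add z sm J A \<longleftrightarrow>
     (\<forall>a\<in>M. a \<noteq> z \<longrightarrow> quot_iso J A (Dset M sm a) (emb ` Ann M z sm a))"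

definition omega1_like :: "'i::wellorder itself \<Rightarrow> bool" where
  "omega1_like _ \<longleftrightarrow> uncountable (UNIV :: 'i set) \<and> (\<forall>x::'i. countable {y. y < x})"

definition is_limit :: "'i::wellorder \<Rightarrow> bool" where
  "is_limit d \<longleftrightarrow> (\<exists>b. b < d) \<and> (\<forall>b<d. \<exists>c. b < c \<and> c < d)"

definition cub :: "'i::wellorder set \<Rightarrow> bool" where
  "cub C \<longleftrightarrow> (\<forall>a. \<exists>c\<in>C. a < c)
     \<and> (\<forall>d. is_limit d \<and> (\<forall>b<d. \<exists>c\<in>C. b < c \<and> c < d) \<longrightarrow> d \<in> C)"

definition stationary :: "'i::wellorder set \<Rightarrow> bool" where
  "stationary S \<longleftrightarrow> (\<forall>C. cub C \<longrightarrow> S \<inter> C \<noteq> {})"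

text \<open>R / (\<Inter>_{s<d} r_s R) with the linear topology given by the images of r_s R (s < d)
  is complete: it is metrizable (d countable), so completeness means every Cauchy
  sequence converges. Since \<Inter>_{s<d} r_s R \<subseteq> r_t R, working with representatives in R,
  x_m - x_n lies in the image of r_s R iff r_s divides x_m - x_n.\<close>
definition quot_complete :: "('i::wellorder \<Rightarrow> 'r::idom) \<Rightarrow> 'i \<Rightarrow> bool" where
  "quot_complete r d \<longleftrightarrow> (\<forall>x :: nat \<Rightarrow> 'r.
     (\<forall>s<d. \<exists>N. \<forall>m\<ge>N. \<forall>n\<ge>N. r s dvd (x m - x n))
     \<longrightarrow> (\<exists>y. \<forall>s<d. \<exists>N. \<forall>n\<ge>N. r s dvd (x n - y)))"

definition Gamma_set :: "('i::wellorder \<Rightarrow> 'r::idom) \<Rightarrow> 'i set" where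
  "Gamma_set r = {d. is_limit d \<and> \<not> quot_complete r d}"

definition represents :: "('i::wellorder \<Rightarrow> 'r::idom) \<Rightarrow> 'r fract set \<Rightarrow> bool" where
  "represents r J \<longleftrightarrow> (\<forall>s. r s \<noteq> 0) \<and> (\<forall>t s. t < s \<longrightarrow> r t dvd r s)
     \<and> J = (\<Union>s. invR (r s))"

end

theory Submission
  imports Defs "HOL-Analysis.Abstract_Topology_2"
begin

text \<open>
  A uniserial module of type \<open>J/R\<close> is a direct limit of the modules \<open>R/r\<^sub>s R\<close> along multiplication
  by \<open>(r\<^sub>t/r\<^sub>s) E\<^sub>t\<^sub>s\<close>, where the \<open>E\<^sub>t\<^sub>s\<close> are units that are coherent modulo \<open>r\<^sub>s\<close>. It is standard only
  if the family is trivial, that is, if it has a thread: units \<open>v\<^sub>s\<close> with \<open>v\<^sub>s \<equiv> E\<^sub>t\<^sub>s v\<^sub>t\<close> modulo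
  \<open>r\<^sub>s\<close>. The family \<open>E\<close> is built one column \<open>(E\<^sub>d\<^sub>s)\<^sub>s\<^sub><\<^sub>d\<close> at a time. The hypothesis \<open>\<Gamma>(J/R) \<noteq> 0\<close>
  implies that the ideals \<open>r\<^sub>s R\<close> do not stabilise.

  If, after thinning out, all quotients \<open>r\<^sub>s R/r\<^sub>t R\<close> are uncountable, exhaust \<open>R\<close> by countable sets
  \<open>N\<^sub>d\<close>. At a limit \<open>d\<close> there are continuum many columns such that no two of them are completed by
  the same \<open>h \<in> R\<close> to a thread with values in \<open>N\<^sub>d\<close>; as \<open>R\<close> does not contain continuum many
  elements, one of them is not completed by any \<open>h\<close>. A thread of the whole family takes values in
  \<open>N\<^sub>d\<close> below some limit \<open>d\<close>, which is a contradiction.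

  Otherwise \<open>r\<^sub>n R/r\<^sub>t R\<close> is countable for a fixed \<open>n\<close> and all \<open>t > n\<close>. Choosing all units congruent
  to 1 modulo \<open>r\<^sub>n\<close>, the approximations of threads form a tree of height \<open>\<omega>\<^sub>1\<close> with countable
  levels, and the columns are chosen together with a strictly increasing map from the tree to the
  rationals, as for a special Aronszajn tree. A thread would then yield an injection of \<open>\<omega>\<^sub>1\<close> into
  the rationals.
\<close>

section \<open>Congruences, units and residues\<close>

definition cong :: "'a::comm_ring_1 \<Rightarrow> 'a \<Rightarrow> 'a \<Rightarrow> bool"  ("(1[_ = _] '(' mod _'))")
  where "[x = y] (mod d) \<longleftrightarrow> d dvd x - y"

lemma cong_refl [simp]: "[x = x] (mod d)"
  by (simp add: cong_def)

lemma cong_sym: "[x = y] (mod d) \<Longrightarrow> [y = x] (mod d)"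
  unfolding cong_def by (metis dvd_minus_iff minus_diff_eq)

lemma cong_trans [trans]: "[x = y] (mod d) \<Longrightarrow> [y = z] (mod d) \<Longrightarrow> [x = z] (mod d)"
  unfolding cong_def using dvd_add[of d "x - y" "y - z"] by simp

lemma cong_cong_iff:
  "[x = x'] (mod d) \<Longrightarrow> [y = y'] (mod d) \<Longrightarrow> [x = y] (mod d) \<longleftrightarrow> [x' = y'] (mod d)"
  using cong_sym cong_trans by blast

lemma cong_add: "[x = y] (mod d) \<Longrightarrow> [u = v] (mod d) \<Longrightarrow> [x + u = y + v] (mod d)"
  unfolding cong_def using dvd_add[of d "x - y" "u - v"] by (simp add: algebra_simps)

lemma cong_scalar_left: "[x = y] (mod d) \<Longrightarrow> [a * x = a * y] (mod d)"
  unfolding cong_def by (simp flip: right_diff_distrib)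

lemma cong_scalar_right: "[x = y] (mod d) \<Longrightarrow> [x * a = y * a] (mod d)"
  using cong_scalar_left[of x y d a] by (simp add: mult.commute)

lemma cong_mult: "[x = y] (mod d) \<Longrightarrow> [u = v] (mod d) \<Longrightarrow> [x * u = y * v] (mod d)"
  using cong_trans cong_scalar_left cong_scalar_right by blast

lemma cong_dvd_modulus: "[x = y] (mod d) \<Longrightarrow> a dvd d \<Longrightarrow> [x = y] (mod a)"
  unfolding cong_def by (rule dvd_trans)

lemma cong_0_iff: "[x = 0] (mod d) \<longleftrightarrow> d dvd x"
  by (simp add: cong_def)

lemma cong_dvd_iff: "[x = y] (mod d) \<Longrightarrow> d dvd x \<longleftrightarrow> d dvd y"
  unfolding cong_0_iff[symmetric] by (rule cong_cong_iff) simp_all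

lemma unit_mult: "u dvd 1 \<Longrightarrow> v dvd 1 \<Longrightarrow> u * v dvd (1::'a::comm_ring_1)"
  using mult_dvd_mono[of u 1 v 1] by simp

definition unit_inverse :: "'a::comm_ring_1 \<Rightarrow> 'a"
  where "unit_inverse u = (SOME w. u * w = 1)"

lemma mult_unit_inverse: "u dvd 1 \<Longrightarrow> u * unit_inverse u = 1"
  unfolding unit_inverse_def dvd_def by (metis (mono_tags, lifting) someI)

lemma unit_unit_inverse: "u dvd 1 \<Longrightarrow> unit_inverse u dvd 1"
  by (metis dvd_triv_right mult_unit_inverse)

lemma mult_unit_inverse_cancel: "u dvd 1 \<Longrightarrow> u * (unit_inverse u * x) = x"
  by (metis mult.assoc mult_1 mult_unit_inverse)

lemma dvd_mult_unit_iff: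
  fixes u :: "'a::comm_ring_1"
  assumes "u dvd 1" shows "d dvd u * x \<longleftrightarrow> d dvd x"
  by (metis assms dvd_mult mult.left_commute mult_unit_inverse_cancel)

lemma cong_mult_unit_cancel: "u dvd 1 \<Longrightarrow> [u * x = u * y] (mod d) \<longleftrightarrow> [x = y] (mod d)"
  unfolding cong_def by (metis dvd_mult_unit_iff right_diff_distrib)

definition residue :: "'a::comm_ring_1 \<Rightarrow> 'a \<Rightarrow> 'a"
  where "residue d x = (SOME y. [y = x] (mod d))"

lemma cong_residue: "[residue d x = x] (mod d)"
  unfolding residue_def by (rule someI[of _ x]) simp

lemma residue_eq_iff: "residue d x = residue d y \<longleftrightarrow> [x = y] (mod d)"
proof
  assume "residue d x = residue d y"
  then show "[x = y] (mod d)" by (metis cong_residue cong_sym cong_trans)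
next
  assume "[x = y] (mod d)"
  then have "[z = x] (mod d) \<longleftrightarrow> [z = y] (mod d)" for z by (rule cong_cong_iff[OF cong_refl])
  then show "residue d x = residue d y" by (simp add: residue_def)
qed

text \<open>Representatives of \<open>aR/bR\<close>, for \<open>a\<close> dividing \<open>b\<close>.\<close>

definition residues :: "'a::comm_ring_1 \<Rightarrow> 'a \<Rightarrow> 'a set"
  where "residues a b = residue b ` {x. a dvd x}"

lemma residues_subset: "a dvd a' \<Longrightarrow> residues a' b \<subseteq> residues a b"
  unfolding residues_def using dvd_trans by blast

lemma residues_lepoll:
  assumes "b dvd c" shows "residues a b \<lesssim> residues a c"
proof -
  have "residue b x = residue b (residue c x)" for x
    unfolding residue_eq_iff by (rule cong_sym[OF cong_dvd_modulus[OF cong_residue assms]])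
  then have "residues a b \<subseteq> residue b ` residues a c" unfolding residues_def by blast
  then show ?thesis by (rule subset_image_lepoll)
qed

lemma one_plus_avoiding:
  assumes "\<not> residues a d \<lesssim> M \<times> N"
  obtains b where "a dvd b" "\<And>m n. m \<in> M \<Longrightarrow> n \<in> N \<Longrightarrow> m dvd 1 \<Longrightarrow> \<not> [m * (1 + b) = n] (mod d)"
proof -
  have "\<not> residues a d \<subseteq> (\<lambda>(m, n). residue d (unit_inverse m * n - 1)) ` (M \<times> N)"
    using assms subset_image_lepoll by blast
  then obtain b where dvd_b: "a dvd b"
    and new: "residue d b \<notin> (\<lambda>(m, n). residue d (unit_inverse m * n - 1)) ` (M \<times> N)"
    unfolding residues_def by blast
  have "\<not> [m * (1 + b) = n] (mod d)" if "m \<in> M" "n \<in> N" "m dvd 1" for m n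
  proof
    assume "[m * (1 + b) = n] (mod d)"
    then have "[m * (1 + b) = m * (unit_inverse m * n)] (mod d)"
      by (simp add: mult_unit_inverse_cancel that(3))
    then have "[1 + b = unit_inverse m * n] (mod d)" by (simp add: cong_mult_unit_cancel that(3))
    then have "[b = unit_inverse m * n - 1] (mod d)" by (simp add: cong_def algebra_simps)
    then show False using new that(1,2) by (force simp: residue_eq_iff)
  qed
  then show ?thesis using dvd_b that by blast
qed

lemma infinite_residues_of_strict_chain:
  fixes a :: "nat \<Rightarrow> 'a::comm_ring_1"
  assumes chain: "\<And>n. a n dvd a (Suc n)" and strict: "\<And>n. \<not> a (Suc n) dvd a n"
    and below: "\<And>n. a n dvd b"
  shows "infinite (residues (a 0) b)"
proof -
  have mono: "a m dvd a n" if "m \<le> n" for m n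
    using that by (induction n rule: dec_induct) (auto intro: dvd_trans chain)
  have "residue b (a m) \<noteq> residue b (a n)" if "m < n" for m n
  proof
    assume "residue b (a m) = residue b (a n)"
    then have "[a m = a n] (mod a (Suc m))"
      using below by (simp add: residue_eq_iff cong_dvd_modulus)
    then have "a (Suc m) dvd a m" using mono[of "Suc m" n] that by (simp add: cong_dvd_iff)
    then show False using strict by blast
  qed
  then have "inj (\<lambda>n. residue b (a n))" by (intro linorder_injI) blast
  then have "infinite (range (\<lambda>n. residue b (a n)))" by (rule range_inj_infinite)
  moreover have "range (\<lambda>n. residue b (a n)) \<subseteq> residues (a 0) b"
    using mono by (auto simp: residues_def)
  ultimately show ?thesis using infinite_super by blast
qed

section \<open>Fractions over a valuation domain\<close>

lemma emb_mult: "emb (a * b) = emb a * emb b"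
  by (simp add: emb_def)

lemma emb_diff: "emb (a - b) = emb a - emb b"
  by (simp add: emb_def)

lemma emb_0 [simp]: "emb 0 = 0"
  by (simp add: emb_def Zero_fract_def)

lemma emb_1 [simp]: "emb 1 = 1"
  by (simp add: emb_def One_fract_def)

lemma emb_minus: "emb (- a) = - emb a"
  using emb_diff[of 0 a] by simp

lemma emb_eq_iff [simp]: "emb a = emb b \<longleftrightarrow> a = b"
  by (simp add: emb_def eq_fract)

lemma emb_eq_0_iff [simp]: "emb a = 0 \<longleftrightarrow> a = 0"
  using emb_eq_iff[of a 0] by simp

lemma emb_associated_unit:
  assumes "g \<noteq> 0" "x = emb v * g" "g = emb w * x" shows "v dvd 1"
proof -
  have "emb (v * w) * g = g" using assms(2,3) unfolding emb_mult by (metis mult.assoc mult.commute)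
  then have "emb (v * w) = emb 1" using assms(1) by simp
  then have "v * w = 1" by (simp only: emb_eq_iff)
  then show ?thesis by (metis dvd_triv_left)
qed

lemma Fract_eq_emb_divide: "b \<noteq> 0 \<Longrightarrow> Fraction_Field.Fract a b = emb a / emb b"
  by (simp add: emb_def)

lemma mem_invR_iff: "c \<noteq> 0 \<Longrightarrow> x \<in> invR c \<longleftrightarrow> (\<exists>s. emb c * x = emb s)"
  unfolding invR_def by (auto simp: Fract_eq_emb_divide field_simps)

lemma invR_mono: assumes "a dvd b" "b \<noteq> 0" shows "invR a \<subseteq> invR b"
proof
  fix x assume x_mem: "x \<in> invR a"
  obtain c where b_eq: "b = c * a" using assms(1) by (metis dvdE mult.commute)
  with assms(2) x_mem obtain s where "emb a * x = emb s" by (auto simp: mem_invR_iff)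
  then have "emb b * x = emb (c * s)" by (simp add: b_eq emb_mult)
  then show "x \<in> invR b" using assms(2) by (auto simp: mem_invR_iff)
qed

lemma invR_eq_scale: assumes "c * k \<noteq> 0" shows "invR c = (\<lambda>y. emb k * y) ` invR (c * k)"
proof (intro equalityI subsetI)
  fix x assume "x \<in> invR c"
  then have "x / emb k \<in> invR (c * k)" using assms by (simp add: mem_invR_iff emb_mult)
  then show "x \<in> (\<lambda>y. emb k * y) ` invR (c * k)"
    using assms by (intro image_eqI[of _ _ "x / emb k"]) simp_all
qed (use assms in \<open>auto simp: mem_invR_iff emb_mult mult_ac\<close>)

lemma Union_invR_divisors:
  assumes "\<And>t. t \<in> T \<Longrightarrow> d t \<noteq> 0"
  shows "\<Union> {invR c | c. c \<noteq> 0 \<and> (\<exists>t\<in>T. c dvd d t)} = (\<Union>t\<in>T. invR (d t))"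
proof (intro equalityI subsetI)
  fix y assume "y \<in> \<Union> {invR c | c. c \<noteq> 0 \<and> (\<exists>t\<in>T. c dvd d t)}"
  then obtain c t where "y \<in> invR c" "t \<in> T" "c dvd d t" by blast
  then show "y \<in> (\<Union>t\<in>T. invR (d t))" using invR_mono assms by blast
next
  fix y assume "y \<in> (\<Union>t\<in>T. invR (d t))"
  then obtain t where t_mem: "t \<in> T" "y \<in> invR (d t)" by blast
  have "invR (d t) \<in> {invR c | c. c \<noteq> 0 \<and> (\<exists>t\<in>T. c dvd d t)}"
    by (intro CollectI exI[of _ "d t"] conjI refl bexI[OF _ t_mem(1)])
      (simp_all add: assms t_mem(1))
  then show "y \<in> \<Union> {invR c | c. c \<noteq> 0 \<and> (\<exists>t\<in>T. c dvd d t)}" using t_mem(2) by (rule UnionI)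
qed

lemma quot_iso_scale:
  assumes "k \<noteq> 0"
  shows "quot_iso J Rset ((\<lambda>y. emb k * y) ` J) (emb ` {c. k dvd c})"
  unfolding quot_iso_def
proof (intro exI[of _ "\<lambda>y. emb k * y"] conjI ballI allI)
  have zero: "0 \<in> emb ` {c. k dvd c}" by (rule image_eqI[of _ _ 0]) auto
  show "\<And>x y. emb k * (x + y) - (emb k * x + emb k * y) \<in> emb ` {c. k dvd c}"
    using zero by (simp add: distrib_left)
  show "\<And>c x. emb k * (emb c * x) - emb c * (emb k * x) \<in> emb ` {c. k dvd c}"
    using zero by (simp add: mult.left_commute)
  show "emb k * x \<in> emb ` {c. k dvd c} \<longleftrightarrow> x \<in> Rset" for x
  proof
    assume "emb k * x \<in> emb ` {c. k dvd c}"
    then obtain c where "emb k * x = emb (k * c)" unfolding dvd_def by blast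
    then show "x \<in> Rset" using assms by (simp add: emb_mult Rset_def)
  qed (auto simp: Rset_def emb_mult[symmetric])
  show "\<exists>x\<in>J. emb k * x - y \<in> emb ` {c. k dvd c}" if "y \<in> (\<lambda>y. emb k * y) ` J" for y
    using that zero by force
qed (rule imageI)

lemma valuation_dvd_total:
  assumes "valuation_domain TYPE('r::idom)" shows "(a::'r) dvd b \<or> b dvd a"
proof -
  have "is_ideal {x. c dvd x}" for c :: 'r
    by (auto simp: is_ideal_def)
  then have "{x. a dvd x} \<subseteq> {x. b dvd x} \<or> {x. b dvd x} \<subseteq> {x. a dvd x}"
    using assms unfolding valuation_domain_def by blast
  then show ?thesis by (metis dvd_refl mem_Collect_eq subsetD)
qed

lemma valuation_fract_total:
  assumes "valuation_domain TYPE('r::idom)"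
  shows "(\<exists>c. y = emb c * x) \<or> (\<exists>c. x = emb c * (y :: 'r fract))"
proof (cases "x = 0")
  case False
  obtain a b where "y / x = Fraction_Field.Fract a b" "b \<noteq> 0" by (cases "y / x")
  then have fraction: "b \<noteq> 0" "emb b * y = emb a * x"
    using False by (simp_all add: Fract_eq_emb_divide field_simps)
  from valuation_dvd_total[OF assms, of b a] show ?thesis
  proof
    assume "b dvd a"
    then obtain c where "a = b * c" ..
    then have "y = emb c * x" using fraction by (simp add: emb_mult)
    then show ?thesis by blast
  next
    assume "a dvd b"
    then obtain c where "b = a * c" ..
    then have "x = emb c * y" using fraction by (simp add: emb_mult)
    then show ?thesis by blast
  qed
qed (metis emb_0 mult_zero_left)

lemma valuation_one_plus_unit:
  assumes "valuation_domain TYPE('r::idom)" "\<not> d dvd 1" "d dvd (x :: 'r)"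
  shows "1 + x dvd 1"
  by (metis assms dvd_add_left_iff dvd_refl dvd_trans valuation_dvd_total)

lemma valuation_cong_unit:
  assumes "valuation_domain TYPE('r::idom)" "\<not> d dvd 1" "[x = y] (mod d)" "(x::'r) dvd 1"
  shows "y dvd 1"
proof -
  let ?w = "unit_inverse x"
  have "d dvd ?w * (y - x)" using cong_sym[OF assms(3)] by (simp add: cong_def)
  then have "1 + ?w * (y - x) dvd 1" by (rule valuation_one_plus_unit[OF assms(1,2)])
  moreover have "1 + ?w * (y - x) = ?w * y"
    using mult_unit_inverse[OF assms(4)] by (simp add: algebra_simps)
  ultimately show ?thesis by (metis dvd_mult_right)
qed

section \<open>Coherent systems of units and their direct limits\<close>

abbreviation bottom :: "'i::wellorder"
  where "bottom \<equiv> LEAST s. True"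

locale valuation_chain =
  fixes r :: "'i::wellorder \<Rightarrow> 'r::idom"
  assumes valuation_domain: "valuation_domain TYPE('r)"
    and nonzero: "r s \<noteq> 0"
    and dvd_mono: "s \<le> t \<Longrightarrow> r s dvd r t"
    and nonunit: "\<not> r s dvd 1"
begin

lemmas dvd_total = valuation_dvd_total[OF valuation_domain]
lemmas one_plus_unit = valuation_one_plus_unit[OF valuation_domain nonunit]
lemmas cong_unit = valuation_cong_unit[OF valuation_domain nonunit]

lemma cong_below: "[x = y] (mod r t) \<Longrightarrow> s \<le> t \<Longrightarrow> [x = y] (mod r s)"
  using cong_dvd_modulus dvd_mono by blast

end

definition thread_on ::
  "('i::order \<Rightarrow> 'r::comm_ring_1) \<Rightarrow> ('i \<Rightarrow> 'i \<Rightarrow> 'r) \<Rightarrow> 'i set \<Rightarrow> ('i \<Rightarrow> 'r) \<Rightarrow> bool"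
  where "thread_on r E A v \<longleftrightarrow>
    (\<forall>s\<in>A. v s dvd 1) \<and> (\<forall>s\<in>A. \<forall>t\<in>A. s \<le> t \<longrightarrow> [v s = E t s * v t] (mod r s))"

text \<open>A candidate for the column \<open>E d\<close>, the columns \<open>E t\<close> with \<open>t < d\<close> being given.\<close>

definition column ::
  "('i::order \<Rightarrow> 'r::comm_ring_1) \<Rightarrow> ('i \<Rightarrow> 'i \<Rightarrow> 'r) \<Rightarrow> 'i \<Rightarrow> ('i \<Rightarrow> 'r) \<Rightarrow> bool"
  where "column r E d Y \<longleftrightarrow> Y d = 1 \<and> thread_on r E {..<d} Y"

lemma column_unit: "column r E d Y \<Longrightarrow> s \<le> d \<Longrightarrow> Y s dvd 1"
  by (cases "s = d") (auto simp: column_def thread_on_def)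

lemma column_cong:
  assumes "column r E d Y" "s \<le> t" "t < d" shows "[Y s = E t s * Y t] (mod r s)"
proof -
  have "s < d" using assms by (meson le_less_trans)
  then show ?thesis using assms by (simp add: column_def thread_on_def)
qed

lemma column_cong_self:
  assumes "column r E d (E d)" "s \<le> t" "t \<le> d"
  shows "[E d s = E t s * E d t] (mod r s)"
proof (cases "t = d")
  case True
  then show ?thesis using assms(1) by (simp add: column_def)
qed (use assms column_cong in force)

lemma column_local:
  assumes "\<And>t. t < d \<Longrightarrow> E t = E' t" shows "column r E d Y \<longleftrightarrow> column r E' d Y"
  using assms by (simp add: column_def thread_on_def)

locale coherent_units = valuation_chain r for r :: "'i::wellorder \<Rightarrow> 'r::idom" +
  fixes E :: "'i \<Rightarrow> 'i \<Rightarrow> 'r"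
  assumes column_E: "column r E d (E d)"
begin

lemma E_refl [simp]: "E s s = 1"
  using column_E by (simp add: column_def)

lemma E_unit: "s \<le> t \<Longrightarrow> E t s dvd 1"
  by (rule column_unit[OF column_E])

lemma E_cong: "s \<le> t \<Longrightarrow> t \<le> p \<Longrightarrow> [E p s = E t s * E p t] (mod r s)"
  by (rule column_cong_self[OF column_E])

definition ratio :: "'i \<Rightarrow> 'i \<Rightarrow> 'r"
  where "ratio s t = (SOME c. r t = r s * c)"

lemma mult_ratio: "s \<le> t \<Longrightarrow> r s * ratio s t = r t"
  unfolding ratio_def using dvd_mono[of s t] by (metis (mono_tags, lifting) dvdE someI)

lemma ratio_nonzero: "s \<le> t \<Longrightarrow> ratio s t \<noteq> 0"
  using mult_ratio nonzero by (metis mult_zero_right)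

lemma ratio_refl [simp]: "ratio s s = 1"
  using mult_ratio[of s s] nonzero[of s] by simp

lemma ratio_trans: assumes "s \<le> t" "t \<le> p" shows "ratio t p * ratio s t = ratio s p"
proof -
  have "r s * (ratio t p * ratio s t) = r s * ratio s p"
    using assms by (metis mult.assoc mult.commute mult_ratio order_trans)
  then show ?thesis using nonzero by simp
qed

text \<open>Multiplication by \<open>transition s t\<close> maps \<open>R/r\<^sub>s R\<close> to \<open>R/r\<^sub>t R\<close>.\<close>

definition transition :: "'i \<Rightarrow> 'i \<Rightarrow> 'r"
  where "transition s t = ratio s t * E t s"

lemma transition_refl [simp]: "transition s s = 1"
  by (simp add: transition_def)

lemma dvd_transition_iff:
  assumes "s \<le> t" shows "r t dvd transition s t * a \<longleftrightarrow> r s dvd a"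
proof -
  have "r t dvd transition s t * a \<longleftrightarrow> ratio s t * r s dvd ratio s t * (E t s * a)"
    using mult_ratio[OF assms] by (simp add: transition_def mult_ac)
  also have "\<dots> \<longleftrightarrow> r s dvd E t s * a" using ratio_nonzero[OF assms] by simp
  also have "\<dots> \<longleftrightarrow> r s dvd a" by (rule dvd_mult_unit_iff[OF E_unit[OF assms]])
  finally show ?thesis .
qed

lemma cong_transition_iff:
  "s \<le> t \<Longrightarrow> [transition s t * a = transition s t * b] (mod r t) \<longleftrightarrow> [a = b] (mod r s)"
  unfolding cong_def by (metis dvd_transition_iff right_diff_distrib)

lemma transition_trans:
  assumes "s \<le> t" "t \<le> p" shows "[transition t p * transition s t = transition s p] (mod r p)"
proof -
  have "r s * ratio s p dvd (E t s * E p t - E p s) * ratio s p"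
    using cong_sym[OF E_cong[OF assms]] by (intro mult_dvd_mono) (simp_all add: cong_def)
  then show ?thesis
    using mult_ratio[OF order_trans[OF assms]]
    by (simp add: cong_def transition_def ratio_trans[OF assms, symmetric] algebra_simps)
qed

lemma cong_transition_transition:
  "s \<le> t \<Longrightarrow> t \<le> p \<Longrightarrow> [transition t p * (transition s t * a) = transition s p * a] (mod r p)"
  using cong_scalar_right[OF transition_trans] by (simp add: mult.assoc)

definition same_germ :: "'i \<times> 'r \<Rightarrow> 'i \<times> 'r \<Rightarrow> bool"
  where "same_germ x y \<longleftrightarrow> (\<exists>p \<ge> max (fst x) (fst y).
    [transition (fst x) p * snd x = transition (fst y) p * snd y] (mod r p))"

lemma cong_level_iff:
  assumes "s \<le> p" "t \<le> p" "p \<le> p'"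
  shows "[transition s p' * a = transition t p' * b] (mod r p') \<longleftrightarrow>
    [transition s p * a = transition t p * b] (mod r p)"
proof -
  have "[transition s p' * a = transition t p' * b] (mod r p') \<longleftrightarrow>
    [transition p p' * (transition s p * a) = transition p p' * (transition t p * b)] (mod r p')"
    using assms by (intro cong_cong_iff cong_sym[OF cong_transition_transition])
  then show ?thesis using cong_transition_iff[OF assms(3)] by blast
qed

lemma same_germ_iff:
  assumes "s \<le> p" "t \<le> p"
  shows "same_germ (s, a) (t, b) \<longleftrightarrow> [transition s p * a = transition t p * b] (mod r p)"
proof
  assume "same_germ (s, a) (t, b)"
  then obtain p' where cong_p': "s \<le> p'" "t \<le> p'"
    "[transition s p' * a = transition t p' * b] (mod r p')"
    by (auto simp: same_germ_def)
  define m where "m = max p p'"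
  have "[transition s m * a = transition t m * b] (mod r m)"
    using cong_level_iff[of s p' t m] cong_p' by (simp add: m_def)
  then show "[transition s p * a = transition t p * b] (mod r p)"
    using cong_level_iff[of s p t m] assms by (simp add: m_def)
qed (use assms in \<open>auto simp: same_germ_def\<close>)

lemma equivp_same_germ: "equivp same_germ"
proof (rule equivpI)
  show "reflp same_germ" by (rule reflpI) (auto simp: same_germ_def)
  show "symp same_germ" by (rule sympI) (auto simp: same_germ_def intro: cong_sym)
  show "transp same_germ"
  proof (rule transpI)
    fix x y z assume "same_germ x y" "same_germ y z"
    moreover obtain s a t b u c where eq: "x = (s, a)" "y = (t, b)" "z = (u, c)"
      by (metis surj_pair)
    moreover define p where "p = max s (max t u)"
    ultimately show "same_germ x z"
      using same_germ_iff[of s p t] same_germ_iff[of t p u] same_germ_iff[of s p u]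
      by (auto simp: le_max_iff_disj intro: cong_trans)
  qed
qed

end

text \<open>The direct limit \<open>U\<close> is presented by its canonical maps \<open>\<iota> s : R \<rightarrow> U\<close>.\<close>

locale direct_limit = coherent_units r E for r :: "'i::wellorder \<Rightarrow> 'r::idom" and E +
  fixes \<iota> :: "'i \<Rightarrow> 'r \<Rightarrow> 'm"
  assumes \<iota>_eq_iff: "\<iota> s a = \<iota> s b \<longleftrightarrow> [a = b] (mod r s)"
    and \<iota>_transition: "s \<le> t \<Longrightarrow> \<iota> t (transition s t * a) = \<iota> s a"
begin

definition limit :: "'m set"
  where "limit = (\<Union>s. range (\<iota> s))"

definition limit_add :: "'m \<Rightarrow> 'm \<Rightarrow> 'm"
  where "limit_add x y = (SOME w. \<exists>s a b. x = \<iota> s a \<and> y = \<iota> s b \<and> w = \<iota> s (a + b))"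

definition limit_scale :: "'r \<Rightarrow> 'm \<Rightarrow> 'm"
  where "limit_scale c x = (SOME w. \<exists>s a. x = \<iota> s a \<and> w = \<iota> s (c * a))"

definition limit_zero :: 'm
  where "limit_zero = \<iota> bottom 0"

lemma \<iota>_in_limit [simp]: "\<iota> s a \<in> limit"
  by (auto simp: limit_def)

lemma \<iota>_eq_\<iota>_iff:
  assumes "s \<le> p" "t \<le> p"
  shows "\<iota> s a = \<iota> t b \<longleftrightarrow> [transition s p * a = transition t p * b] (mod r p)"
  using assms by (metis \<iota>_eq_iff \<iota>_transition)

lemma limit_add_\<iota>: "limit_add (\<iota> s a) (\<iota> s b) = \<iota> s (a + b)"
proof -
  have "\<iota> t (a' + b') = \<iota> s (a + b)" if "\<iota> s a = \<iota> t a'" "\<iota> s b = \<iota> t b'" for t a' b'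
  proof -
    define p where "p = max s t"
    have p_upper: "s \<le> p" "t \<le> p" by (auto simp: p_def)
    have "[transition s p * a + transition s p * b =
        transition t p * a' + transition t p * b'] (mod r p)"
      using that unfolding \<iota>_eq_\<iota>_iff[OF p_upper] by (rule cong_add)
    then show ?thesis unfolding \<iota>_eq_\<iota>_iff[OF p_upper(2,1)] distrib_left by (rule cong_sym)
  qed
  then show ?thesis unfolding limit_add_def by (intro some_equality) (blast, metis)
qed

lemma limit_scale_\<iota>: "limit_scale c (\<iota> s a) = \<iota> s (c * a)"
proof -
  have "\<iota> t (c * a') = \<iota> s (c * a)" if "\<iota> s a = \<iota> t a'" for t a'
  proof -
    define p where "p = max s t"
    have p_upper: "s \<le> p" "t \<le> p" by (auto simp: p_def)
    have "[c * (transition s p * a) = c * (transition t p * a')] (mod r p)"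
      using that unfolding \<iota>_eq_\<iota>_iff[OF p_upper] by (rule cong_scalar_left)
    then show ?thesis
      unfolding \<iota>_eq_\<iota>_iff[OF p_upper(2,1)] mult.left_commute[of _ c] by (rule cong_sym)
  qed
  then show ?thesis unfolding limit_scale_def by (intro some_equality) (blast, metis)
qed

lemma \<iota>_0: "\<iota> s 0 = limit_zero"
  unfolding limit_zero_def using \<iota>_transition[of bottom s 0] by (simp add: Least_le)

lemma \<iota>_eq_zero_iff: "\<iota> s a = limit_zero \<longleftrightarrow> r s dvd a"
  using \<iota>_eq_iff[of s a 0] by (simp add: \<iota>_0 cong_0_iff)

lemma range_\<iota>_mono: "s \<le> t \<Longrightarrow> range (\<iota> s) \<subseteq> range (\<iota> t)"
  using \<iota>_transition by (metis image_subsetI rangeI)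

lemma finite_subset_limit:
  assumes "finite X" "X \<subseteq> limit" obtains s where "p \<le> s" "X \<subseteq> range (\<iota> s)"
proof -
  from assms have "\<exists>s\<ge>p. X \<subseteq> range (\<iota> s)"
  proof (induction X)
    case (insert x X)
    then obtain s t where "p \<le> s" "X \<subseteq> range (\<iota> s)" "x \<in> range (\<iota> t)" by (auto simp: limit_def)
    then show ?case
      using range_\<iota>_mono[of s "max s t"] range_\<iota>_mono[of t "max s t"]
      by (intro exI[of _ "max s t"]) (auto simp: le_max_iff_disj)
  qed blast
  then show ?thesis using that by blast
qed

lemma is_module_limit: "is_module limit limit_add limit_zero limit_scale"
  unfolding is_module_def
proof (intro conjI ballI allI)
  show "limit_zero \<in> limit" by (simp add: limit_zero_def)
  fix x assume "x \<in> limit"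
  then obtain s a where x_eq: "x = \<iota> s a" by (auto simp: limit_def)
  show "limit_add limit_zero x = x" using limit_add_\<iota>[of s 0 a] by (simp add: x_eq \<iota>_0)
  show "limit_scale 1 x = x" by (simp add: x_eq limit_scale_\<iota>)
  show "\<exists>y\<in>limit. limit_add x y = limit_zero"
    by (rule bexI[of _ "\<iota> s (- a)"]) (simp_all add: x_eq limit_add_\<iota> \<iota>_0)
  fix c d
  show "limit_scale c x \<in> limit" by (simp add: x_eq limit_scale_\<iota>)
  show "limit_scale (c + d) x = limit_add (limit_scale c x) (limit_scale d x)"
    by (simp add: x_eq limit_scale_\<iota> limit_add_\<iota> distrib_right)
  show "limit_scale (c * d) x = limit_scale c (limit_scale d x)"
    by (simp add: x_eq limit_scale_\<iota> mult.assoc)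
next
  fix x y assume "x \<in> limit" "y \<in> limit"
  then have "{x, y} \<subseteq> limit" by simp
  then obtain s where "{x, y} \<subseteq> range (\<iota> s)" using finite_subset_limit by (metis finite.simps)
  then obtain a b where xy_eq: "x = \<iota> s a" "y = \<iota> s b" by auto
  show "limit_add x y \<in> limit" by (simp add: xy_eq limit_add_\<iota>)
  show "limit_add x y = limit_add y x" by (simp add: xy_eq limit_add_\<iota> add.commute)
  show "limit_scale c (limit_add x y) = limit_add (limit_scale c x) (limit_scale c y)" for c
    by (simp add: xy_eq limit_add_\<iota> limit_scale_\<iota> distrib_left)
next
  fix x y w assume "x \<in> limit" "y \<in> limit" "w \<in> limit"
  then have "{x, y, w} \<subseteq> limit" by simp
  then obtain s where "{x, y, w} \<subseteq> range (\<iota> s)" using finite_subset_limit by (metis finite.simps)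
  then obtain a b c where "x = \<iota> s a" "y = \<iota> s b" "w = \<iota> s c" by auto
  then show "limit_add (limit_add x y) w = limit_add x (limit_add y w)"
    by (simp add: limit_add_\<iota> add.assoc)
qed

lemma limit_multiple_total:
  assumes "x \<in> limit" "y \<in> limit"
  shows "(\<exists>c. y = limit_scale c x) \<or> (\<exists>c. x = limit_scale c y)"
proof -
  have "{x, y} \<subseteq> limit" using assms by simp
  then obtain s where "{x, y} \<subseteq> range (\<iota> s)" using finite_subset_limit by (metis finite.simps)
  then obtain a b where "x = \<iota> s a" "y = \<iota> s b" by auto
  then show ?thesis using dvd_total[of a b] by (auto simp: limit_scale_\<iota> dvd_def mult.commute)
qed

lemma uniserial_limit: "uniserial limit limit_add limit_zero limit_scale"
proof -
  have "M \<subseteq> N \<or> N \<subseteq> M"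
    if sub: "submodule M limit limit_add limit_zero limit_scale"
      "submodule N limit limit_add limit_zero limit_scale" for M N
  proof (rule ccontr)
    assume "\<not> ?thesis"
    then obtain x y where "x \<in> M" "x \<notin> N" "y \<in> N" "y \<notin> M" by blast
    then show False using limit_multiple_total[of x y] sub unfolding submodule_def by blast
  qed
  then show ?thesis using is_module_limit by (auto simp: uniserial_def)
qed

lemma \<iota>_divisible_iff:
  assumes "\<not> r s dvd a"
  shows "(\<exists>u\<in>limit. \<iota> s a = limit_scale c u) \<longleftrightarrow> (\<exists>t\<in>{s..}. c dvd ratio s t * a)"
proof
  assume "\<exists>u\<in>limit. \<iota> s a = limit_scale c u"
  then obtain u where u_multiple: "u \<in> limit" "\<iota> s a = limit_scale c u" by blast
  then have "{u} \<subseteq> limit" by simp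
  then obtain t where s_le_t: "s \<le> t" and "{u} \<subseteq> range (\<iota> t)"
    using finite_subset_limit by (metis finite.simps)
  then obtain b where "u = \<iota> t b" by auto
  then have lift: "[transition s t * a = c * b] (mod r t)"
    using u_multiple(2) by (simp add: limit_scale_\<iota> \<iota>_transition[OF s_le_t] flip: \<iota>_eq_iff)
  have "\<not> r t dvd c * b" using cong_dvd_iff[OF lift] dvd_transition_iff[OF s_le_t] assms by blast
  then have "\<not> r t dvd c" using dvd_mult2 by blast
  then have "c dvd r t" using dvd_total by blast
  then have "c dvd transition s t * a"
    using cong_dvd_iff[OF cong_dvd_modulus[OF lift]] by simp
  then have "c dvd E t s * (ratio s t * a)" by (simp add: transition_def mult_ac)
  then show "\<exists>t\<in>{s..}. c dvd ratio s t * a"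
    using s_le_t by (auto simp: dvd_mult_unit_iff[OF E_unit])
next
  assume "\<exists>t\<in>{s..}. c dvd ratio s t * a"
  then obtain t d where s_le_t: "s \<le> t" and "ratio s t * a = c * d" unfolding dvd_def by blast
  then have "transition s t * a = c * (d * E t s)" by (simp add: transition_def mult_ac)
  then have "\<iota> s a = limit_scale c (\<iota> t (d * E t s))"
    by (simp add: limit_scale_\<iota> flip: \<iota>_transition[OF s_le_t])
  then show "\<exists>u\<in>limit. \<iota> s a = limit_scale c u" by auto
qed

lemma Dset_\<iota>:
  assumes J_eq: "J = (\<Union>t. invR (r t))" and r_s_eq: "r s = a * k" and not_dvd: "\<not> r s dvd a"
  shows "Dset limit limit_scale (\<iota> s a) = (\<lambda>y. emb k * y) ` J"
proof -
  have r_t_eq: "r t = ratio s t * a * k" if "s \<le> t" for t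
    using mult_ratio[OF that] r_s_eq by (simp add: mult_ac)
  have factor_nonzero: "ratio s t * a \<noteq> 0" if "s \<le> t" for t
    using r_t_eq[OF that] nonzero[of t] by auto
  have scaled: "invR (ratio s t * a) = (\<lambda>y. emb k * y) ` invR (r t)" if "s \<le> t" for t
    using r_t_eq[OF that] nonzero[of t] invR_eq_scale[of "ratio s t * a" k] by simp
  have "Dset limit limit_scale (\<iota> s a) = \<Union> {invR c | c. c \<noteq> 0 \<and> (\<exists>t\<in>{s..}. c dvd ratio s t * a)}"
    unfolding Dset_def \<iota>_divisible_iff[OF not_dvd] ..
  also have "\<dots> = (\<Union>t\<in>{s..}. invR (ratio s t * a))"
    by (rule Union_invR_divisors) (use factor_nonzero in auto)
  also have "\<dots> = (\<Union>t\<in>{s..}. (\<lambda>y. emb k * y) ` invR (r t))" using scaled by simp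
  also have "\<dots> = (\<lambda>y. emb k * y) ` (\<Union>t\<in>{s..}. invR (r t))" by (simp add: image_UN)
  also have "(\<Union>t\<in>{s..}. invR (r t)) = J"
  proof
    have "invR (r t) \<subseteq> invR (r (max s t))" for t by (intro invR_mono dvd_mono nonzero) simp
    then have "invR (r t) \<subseteq> (\<Union>t\<in>{s..}. invR (r t))" for t by (rule order_trans[OF _ UN_upper]) simp
    then show "J \<subseteq> (\<Union>t\<in>{s..}. invR (r t))" unfolding J_eq by (rule UN_least)
  qed (auto simp: J_eq)
  finally show ?thesis .
qed

lemma has_type_limit:
  assumes "represents r J" shows "has_type limit limit_add limit_zero limit_scale J Rset"
  unfolding has_type_def
proof (intro ballI impI)
  fix x assume "x \<in> limit" "x \<noteq> limit_zero"
  then obtain s a where x_eq: "x = \<iota> s a" and not_dvd: "\<not> r s dvd a"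
    by (auto simp: limit_def \<iota>_eq_zero_iff)
  then obtain k where r_s_eq: "r s = a * k" using dvd_total[of "r s" a] by (auto simp: dvd_def)
  then have factors_nonzero: "a \<noteq> 0" "k \<noteq> 0" using nonzero[of s] by auto
  have "Ann limit limit_zero limit_scale x = {c. k dvd c}"
    using factors_nonzero
    by (auto simp: x_eq Ann_def limit_scale_\<iota> \<iota>_eq_zero_iff r_s_eq mult.commute)
  moreover have "Dset limit limit_scale x = (\<lambda>y. emb k * y) ` J"
    unfolding x_eq using assms r_s_eq not_dvd by (intro Dset_\<iota>) (simp_all add: represents_def)
  ultimately show
    "quot_iso J Rset (Dset limit limit_scale x) (emb ` Ann limit limit_zero limit_scale x)"
    using quot_iso_scale[OF factors_nonzero(2)] by simp
qed

lemma kernel_eq_multiples: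
  assumes hom: "\<And>c y. y \<in> J' \<Longrightarrow> f (emb c * y) = limit_scale c (f y)"
    and x_lift: "x \<in> J'" "f x = \<iota> s 1" and y_mem: "y \<in> J'"
  shows "f y = limit_zero \<longleftrightarrow> (\<exists>c. y = emb c * (emb (r s) * x))"
proof
  assume fy_zero: "f y = limit_zero"
  have "x \<noteq> emb c * y" for c
  proof
    assume "x = emb c * y"
    then have "\<iota> s 1 = limit_scale c (\<iota> s 0)" using hom[OF y_mem] x_lift(2) fy_zero \<iota>_0 by metis
    then show False using nonunit by (simp add: limit_scale_\<iota> \<iota>_eq_iff cong_0_iff)
  qed
  then obtain c where y_eq: "y = emb c * x"
    using valuation_fract_total[OF valuation_domain] by metis
  then have "\<iota> s c = limit_zero"
    using hom[OF x_lift(1)] x_lift(2) fy_zero by (simp add: limit_scale_\<iota>)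
  then show "\<exists>c. y = emb c * (emb (r s) * x)"
    by (auto simp: y_eq \<iota>_eq_zero_iff emb_mult mult_ac elim!: dvdE)
next
  assume "\<exists>c. y = emb c * (emb (r s) * x)"
  then obtain c where "y = emb (c * r s) * x" by (auto simp: emb_mult mult.assoc)
  then show "f y = limit_zero"
    using hom[OF x_lift(1), of "c * r s"] x_lift(2) by (simp add: limit_scale_\<iota> \<iota>_eq_zero_iff)
qed

lemma lift_of_one_nonzero:
  assumes hom: "\<And>c y. y \<in> J' \<Longrightarrow> f (emb c * y) = limit_scale c (f y)"
    and x_lift: "x \<in> J'" "f x = \<iota> s 1"
  shows "x \<noteq> 0"
proof
  assume "x = 0"
  then have "\<iota> s 1 = limit_scale 0 (\<iota> s 1)" using hom[OF x_lift(1), of 0] x_lift(2) by simp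
  then show False using nonunit by (simp add: limit_scale_\<iota> \<iota>_eq_iff cong_0_iff)
qed

lemma kernel_generators_associated:
  assumes hom: "\<And>c y. y \<in> J' \<Longrightarrow> f (emb c * y) = limit_scale c (f y)"
    and closed: "\<And>c y. y \<in> J' \<Longrightarrow> emb c * y \<in> J'"
    and x_lift: "x \<in> J'" "f x = \<iota> s 1" and y_lift: "y \<in> J'" "f y = \<iota> t 1"
  shows "\<exists>v. v dvd 1 \<and> emb (r s) * x = emb v * (emb (r t) * y)"
proof -
  have "f (emb (r s) * x) = limit_zero" "f (emb (r t) * y) = limit_zero"
    by (simp_all add: hom x_lift y_lift limit_scale_\<iota> \<iota>_eq_zero_iff)
  then obtain v w where "emb (r s) * x = emb v * (emb (r t) * y)"
    and "emb (r t) * y = emb w * (emb (r s) * x)"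
    using kernel_eq_multiples[OF hom y_lift closed[OF x_lift(1)]]
      kernel_eq_multiples[OF hom x_lift closed[OF y_lift(1)]]
    by blast
  moreover have "emb (r t) * y \<noteq> 0" using lift_of_one_nonzero[OF hom y_lift] nonzero by simp
  ultimately show ?thesis using emb_associated_unit by blast
qed

lemma standard_lifts:
  assumes "standard limit limit_add limit_zero limit_scale"
  obtains g v x where "g \<noteq> 0" "\<And>s. v s dvd 1" "\<And>s. emb (r s) * x s = emb (v s) * g"
    "\<And>s t. s \<le> t \<Longrightarrow> \<exists>c. x s - emb (transition s t) * x t = emb c * g"
proof -
  obtain J' A and f :: "'r fract \<Rightarrow> 'm" where "Q_submodule J'"
    and add: "\<forall>x\<in>J'. \<forall>y\<in>J'. f (x + y) = limit_add (f x) (f y)"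
    and "\<forall>c. \<forall>x\<in>J'. f (emb c * x) = limit_scale c (f x)" and onto: "f ` J' = limit"
    using assms unfolding standard_def by (elim exE conjE) (rule that)
  then have hom: "\<And>c x. x \<in> J' \<Longrightarrow> f (emb c * x) = limit_scale c (f x)"
    and closed: "\<And>c x. x \<in> J' \<Longrightarrow> emb c * x \<in> J'" "\<And>x y. x \<in> J' \<Longrightarrow> y \<in> J' \<Longrightarrow> x + y \<in> J'"
    by (auto simp: Q_submodule_def)
  have "\<forall>s. \<exists>x\<in>J'. f x = \<iota> s 1" using onto \<iota>_in_limit by (metis imageE)
  then obtain x where x_lift: "\<And>s. x s \<in> J'" "\<And>s. f (x s) = \<iota> s 1" by metis
  fix s\<^sub>0 :: 'i
  define g where "g = emb (r s\<^sub>0) * x s\<^sub>0"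
  have g_nonzero: "g \<noteq> 0" using lift_of_one_nonzero[OF hom x_lift] nonzero by (simp add: g_def)
  have "\<exists>v. v dvd 1 \<and> emb (r s) * x s = emb v * g" for s
    unfolding g_def by (rule kernel_generators_associated[OF hom closed(1) x_lift x_lift])
  then obtain v where v_generates: "\<And>s. v s dvd 1" "\<And>s. emb (r s) * x s = emb (v s) * g" by metis
  have "\<exists>c. x s - emb (transition s t) * x t = emb c * g" if "s \<le> t" for s t
  proof -
    let ?y = "x s + emb (- transition s t) * x t"
    have "f ?y = limit_add (\<iota> t (transition s t)) (\<iota> t (- transition s t))"
      using add hom x_lift closed \<iota>_transition[OF that, of 1] by (simp add: limit_scale_\<iota>)
    then have "f ?y = limit_zero" by (simp add: limit_add_\<iota> \<iota>_0)
    moreover have "?y \<in> J'" using closed x_lift by blast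
    ultimately obtain c where "?y = emb c * g"
      using kernel_eq_multiples[OF hom x_lift] unfolding g_def by blast
    then show ?thesis by (auto simp: emb_minus)
  qed
  then show ?thesis using that g_nonzero v_generates by blast
qed

lemma standard_imp_thread:
  assumes "standard limit limit_add limit_zero limit_scale"
  shows "\<exists>v. thread_on r E UNIV v"
proof -
  obtain g v x where g_nonzero: "g \<noteq> 0" and unit: "\<And>s. v s dvd 1"
    and v_generates: "\<And>s. emb (r s) * x s = emb (v s) * g"
    and diff: "\<And>s t. s \<le> t \<Longrightarrow> \<exists>c. x s - emb (transition s t) * x t = emb c * g"
    by (rule standard_lifts[OF assms]) (rule that)
  have "[v s = E t s * v t] (mod r s)" if s_le_t: "s \<le> t" for s t
  proof -
    obtain c where diff_eq: "x s - emb (transition s t) * x t = emb c * g"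
      using diff[OF s_le_t] by blast
    have "emb (r t * c) * g = emb (r t) * (x s - emb (transition s t) * x t)"
      unfolding diff_eq emb_mult by (rule mult.assoc)
    also have "\<dots> = emb (ratio s t) * (emb (r s) * x s) - emb (transition s t) * (emb (r t) * x t)"
      by (simp add: mult_ratio[OF s_le_t, symmetric] emb_mult algebra_simps)
    also have "\<dots> = emb (ratio s t * (v s - E t s * v t)) * g"
      unfolding v_generates by (simp add: transition_def emb_mult emb_diff algebra_simps)
    finally have "ratio s t * (r s * c) = ratio s t * (v s - E t s * v t)"
      using g_nonzero by (simp add: mult_ratio[OF s_le_t, symmetric] mult_ac)
    then have "v s - E t s * v t = r s * c" using ratio_nonzero[OF s_le_t] by simp
    then show ?thesis by (simp add: cong_def)
  qed
  then show ?thesis using unit by (auto simp: thread_on_def)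
qed

end

theorem (in coherent_units) nonstandard_uniserial_exists:
  assumes no_thread: "\<nexists>v. thread_on r E UNIV v"
    and small: "(UNIV :: ('i \<times> 'r) set) \<lesssim> (UNIV :: 'm set)"
    and rep: "represents r J"
  shows "\<exists>(M :: 'm set set) add z sm.
    uniserial M add z sm \<and> \<not> standard M add z sm \<and> has_type M add z sm J Rset"
proof -
  obtain \<phi> :: "'i \<times> 'r \<Rightarrow> 'm" where inj_\<phi>: "inj \<phi>" using small unfolding lepoll_def by blast
  define \<iota> where "\<iota> s a = \<phi> ` Collect (same_germ (s, a))" for s a
  have "\<iota> s a = \<iota> t b \<longleftrightarrow> same_germ (s, a) = same_germ (t, b)" for s t a b
    unfolding \<iota>_def inj_image_eq_iff[OF inj_\<phi>] by (auto dest: Collect_inj)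
  then have \<iota>_eq: "\<iota> s a = \<iota> t b \<longleftrightarrow> same_germ (s, a) (t, b)" for s t a b
    using equivp_same_germ unfolding equivp_def by blast
  interpret direct_limit r E \<iota>
  proof
    show "\<iota> s a = \<iota> s b \<longleftrightarrow> [a = b] (mod r s)" for s a b
      using same_germ_iff[of s s s] by (simp add: \<iota>_eq)
    show "\<iota> t (transition s t * a) = \<iota> s a" if "s \<le> t" for s t a
      using same_germ_iff[OF order_refl that] by (simp add: \<iota>_eq)
  qed
  have "\<not> standard limit limit_add limit_zero limit_scale"
    using standard_imp_thread no_thread by blast
  then show ?thesis using uniserial_limit has_type_limit[OF rep] by blast
qed

section \<open>Well-orders of type \<open>\<omega>\<^sub>1\<close>\<close>

lemma omega1_bounded:
  assumes "omega1_like TYPE('i::wellorder)" "countable (A :: 'i set)"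
  obtains b where "\<And>a. a \<in> A \<Longrightarrow> a < b"
proof (rule ccontr)
  assume "\<not> thesis"
  then have "\<forall>b. \<exists>a\<in>A. b \<le> a" using that by (meson not_le)
  then have "UNIV \<subseteq> (\<Union>a\<in>A. insert a {y. y < a})" by (force simp: order_le_less)
  moreover have "countable (\<Union>a\<in>A. insert a {y. y < a})"
    using assms by (auto simp: omega1_like_def)
  ultimately show False using assms(1) countable_subset unfolding omega1_like_def by blast
qed

lemma omega1_subchain:
  fixes n :: "'i::wellorder"
  assumes omega1: "omega1_like TYPE('i)"
    and ex_Q: "\<And>s :: 'i. \<exists>t. Q s t" and Q_upward: "\<And>s t u :: 'i. Q s t \<Longrightarrow> t \<le> u \<Longrightarrow> Q s u"
  obtains g :: "'i \<Rightarrow> 'i" where "strict_mono g" "\<And>s t. s < t \<Longrightarrow> Q (g s) (g t)"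
    "\<And>s. n \<le> g s" "\<And>s. s \<le> g s"
proof -
  obtain h where Q_h: "\<And>s. Q s (h s)" using ex_Q by metis
  have "\<exists>g. \<forall>s. n \<le> g s \<and> s \<le> g s \<and> (\<forall>t<s. g t < g s \<and> Q (g t) (g s))"
  proof (rule dependent_wellorder_choice)
    fix s and g :: "'i \<Rightarrow> 'i"
    let ?A = "{n, s} \<union> g ` {t. t < s} \<union> h ` g ` {t. t < s}"
    have "countable ?A" using omega1 by (auto simp: omega1_like_def)
    then obtain b where b_upper: "\<And>a. a \<in> ?A \<Longrightarrow> a < b" using omega1_bounded[OF omega1] by blast
    have "Q (g t) b" if "t < s" for t
      using Q_upward[OF Q_h[of "g t"], of b] b_upper[of "h (g t)"] that by auto
    then show "\<exists>b. n \<le> b \<and> s \<le> b \<and> (\<forall>t<s. g t < b \<and> Q (g t) b)"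
      using b_upper by (auto intro!: exI[of _ b] less_imp_le)
  qed auto
  then obtain g where "\<And>s. n \<le> g s" "\<And>s. s \<le> g s" "\<And>s t. t < s \<Longrightarrow> g t < g s \<and> Q (g t) (g s)"
    by blast
  then show ?thesis using that[of g] by (simp add: strict_mono_def)
qed

lemma omega1_limit_of_seq:
  fixes a :: "nat \<Rightarrow> 'i::wellorder"
  assumes "omega1_like TYPE('i)" "strict_mono a"
  obtains d where "is_limit d" "\<And>n. a n < d" "\<And>s. s < d \<Longrightarrow> \<exists>n. s < a n"
proof -
  have "countable (range a)" by simp
  then obtain u where u_upper: "\<And>x. x \<in> range a \<Longrightarrow> x < u" using omega1_bounded[OF assms(1)] by blast
  define d where "d = (LEAST u. \<forall>n. a n < u)"
  have below: "a n < d" for n unfolding d_def by (rule LeastI2[of _ u]) (use u_upper in auto)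
  have cofinal: "\<exists>n. s < a n" if "s < d" for s
  proof -
    have "\<exists>n. s \<le> a n" using not_less_Least[OF that[unfolded d_def]] by (auto simp: not_less)
    then obtain n where "s \<le> a n" ..
    also have "a n < a (Suc n)" using assms(2) by (simp add: strict_mono_Suc_iff)
    finally show ?thesis ..
  qed
  have "is_limit d" unfolding is_limit_def using below cofinal by blast
  then show ?thesis using that below cofinal by blast
qed

lemma omega1_closure_point:
  fixes \<psi> :: "'i::wellorder \<Rightarrow> 'i"
  assumes omega1: "omega1_like TYPE('i)"
  obtains d where "is_limit d" "\<And>s. s < d \<Longrightarrow> \<psi> s < d"
proof -
  have "\<exists>b>x. \<forall>y\<le>x. \<psi> y < b" for x
  proof -
    have "countable ({x} \<union> \<psi> ` insert x {y. y < x})" using omega1 by (auto simp: omega1_like_def)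
    then obtain b where "\<And>a. a \<in> {x} \<union> \<psi> ` insert x {y. y < x} \<Longrightarrow> a < b"
      using omega1_bounded[OF omega1] by blast
    then show ?thesis by (auto simp: order_le_less)
  qed
  then obtain b where b_bounds: "\<And>x. x < b x" "\<And>x y. y \<le> x \<Longrightarrow> \<psi> y < b x" by metis
  define a where "a n = (b ^^ n) undefined" for n
  have a_Suc: "a (Suc n) = b (a n)" for n by (simp add: a_def)
  then have "strict_mono a" using b_bounds(1) by (simp add: strict_mono_Suc_iff)
  then obtain d where d_limit: "is_limit d" "\<And>n. a n < d" "\<And>s. s < d \<Longrightarrow> \<exists>n. s < a n"
    using omega1_limit_of_seq[OF omega1] by blast
  have "\<psi> s < d" if "s < d" for s
  proof -
    obtain n where "s < a n" using d_limit(3) \<open>s < d\<close> by blast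
    then have "\<psi> s < a (Suc n)" using a_Suc b_bounds(2) by simp
    then show ?thesis using d_limit(2) less_trans by blast
  qed
  then show ?thesis using that d_limit(1) by blast
qed

definition cofinal_below :: "'i::order \<Rightarrow> (nat \<Rightarrow> 'i) \<Rightarrow> bool"
  where "cofinal_below d s \<longleftrightarrow> mono s \<and> (\<forall>k. s k < d) \<and> (\<forall>x<d. \<exists>k. x \<le> s k)"

lemma cofinal_belowD:
  assumes "cofinal_below d s"
  shows "k \<le> l \<Longrightarrow> s k \<le> s l" "s k < d" "x < d \<Longrightarrow> \<exists>k. x \<le> s k"
  using assms by (auto simp: cofinal_below_def mono_def)

lemma omega1_cofinal_below:
  fixes c d :: "'i::wellorder"
  assumes omega1: "omega1_like TYPE('i)" and "c < d"
  obtains s where "cofinal_below d s" "is_limit d \<Longrightarrow> strict_mono s"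
proof -
  have nonempty: "{y. y < d} \<noteq> {}" and countable: "countable {y. y < d}"
    using assms by (auto simp: omega1_like_def)
  define a where "a = from_nat_into {y. y < d}"
  have a_less: "a n < d" for n using from_nat_into[OF nonempty] by (simp add: a_def)
  have "\<exists>s. \<forall>n. (s n < d \<and> a n \<le> s n) \<and> s n \<le> s (Suc n) \<and> (is_limit d \<longrightarrow> s n < s (Suc n))"
  proof (rule dependent_nat_choice)
    show "\<exists>x. x < d \<and> a 0 \<le> x" using a_less by blast
    fix x n assume "x < d \<and> a n \<le> x"
    then have max_less: "max x (a (Suc n)) < d" using a_less by simp
    show "\<exists>y. (y < d \<and> a (Suc n) \<le> y) \<and> x \<le> y \<and> (is_limit d \<longrightarrow> x < y)"
    proof (cases "is_limit d")
      case True
      then obtain y where "max x (a (Suc n)) < y" "y < d"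
        using max_less unfolding is_limit_def by blast
      then show ?thesis by (intro exI[of _ y]) auto
    next
      case False
      then show ?thesis using max_less by (intro exI[of _ "max x (a (Suc n))"]) auto
    qed
  qed
  then obtain s where s_seq: "\<And>n. s n < d" "\<And>n. a n \<le> s n" "\<And>n. s n \<le> s (Suc n)"
    "\<And>n. is_limit d \<Longrightarrow> s n < s (Suc n)" by blast
  have "\<exists>n. x \<le> s n" if "x < d" for x
    using from_nat_into_surj[OF countable, of x] that s_seq(2) by (auto simp: a_def)
  then have "cofinal_below d s" using s_seq(1,3) by (simp add: cofinal_below_def mono_iff_le_Suc)
  then show ?thesis using that s_seq(4) by (simp add: strict_mono_Suc_iff)
qed

lemma omega1_lepoll_uncountable:
  fixes S :: "'i::wellorder set"
  assumes omega1: "omega1_like TYPE('i)" and uncountable_S: "uncountable S"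
  shows "(UNIV :: 'i set) \<lesssim> S"
proof -
  have "\<exists>g. \<forall>s :: 'i. g s \<in> S \<and> (\<forall>t<s. g s \<noteq> g t)"
  proof (rule dependent_wellorder_choice)
    fix s and g :: "'i \<Rightarrow> 'i"
    have "countable (g ` {t. t < s})" using omega1 by (simp add: omega1_like_def)
    then have "\<not> S \<subseteq> g ` {t. t < s}" using uncountable_S countable_subset by blast
    then show "\<exists>v. v \<in> S \<and> (\<forall>t<s. v \<noteq> g t)" by blast
  qed simp
  then obtain g :: "'i \<Rightarrow> 'i" where g_avoids: "\<And>s. g s \<in> S" "\<And>s t. t < s \<Longrightarrow> g s \<noteq> g t" by metis
  have "inj g" by (rule linorder_injI) (metis g_avoids(2))
  moreover have "range g \<subseteq> S" using g_avoids(1) by blast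
  ultimately show ?thesis unfolding lepoll_def by blast
qed

lemma not_nat_sets_lepoll_omega1:
  assumes omega1: "omega1_like TYPE('i::wellorder)"
    and notCH: "\<not> (UNIV :: 'i set) \<approx> (UNIV :: real set)"
  shows "\<not> (UNIV :: nat set set) \<lesssim> (UNIV :: 'i set)"
proof
  assume "(UNIV :: nat set set) \<lesssim> (UNIV :: 'i set)"
  then have real: "(UNIV :: real set) \<lesssim> (UNIV :: 'i set)"
    using nat_sets_eqpoll_reals eqpoll_sym lepoll_trans1 by blast
  then obtain f :: "real \<Rightarrow> 'i" where "inj f" unfolding lepoll_def by blast
  then have "uncountable (range f)" using uncountable_UNIV_real countable_image_inj_on by blast
  then have "(UNIV :: 'i set) \<lesssim> range f" by (rule omega1_lepoll_uncountable[OF omega1])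
  also have "range f \<lesssim> (UNIV :: real set)" by (rule image_lepoll)
  finally show False using notCH real lepoll_antisym by blast
qed

section \<open>Extending coherent systems by a column\<close>

locale coherent_below = valuation_chain r for r :: "'i::wellorder \<Rightarrow> 'r::idom" +
  fixes E :: "'i \<Rightarrow> 'i \<Rightarrow> 'r" and d :: 'i
  assumes column_E: "t < d \<Longrightarrow> column r E t (E t)"
begin

lemma E_refl: "t < d \<Longrightarrow> E t t = 1"
  using column_E by (simp add: column_def)

lemma E_unit: "s \<le> t \<Longrightarrow> t < d \<Longrightarrow> E t s dvd 1"
  by (rule column_unit[OF column_E])

lemma E_cong: "s \<le> t \<Longrightarrow> t \<le> p \<Longrightarrow> p < d \<Longrightarrow> [E p s = E t s * E p t] (mod r s)"
  by (rule column_cong_self[OF column_E])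

lemma cong_along_seq:
  assumes cofinal: "cofinal_below d s"
    and compatible: "\<And>k. [X k = E (s (Suc k)) (s k) * X (Suc k)] (mod r (s k))"
    and "x \<le> s k" "k \<le> l"
  shows "[E (s k) x * X k = E (s l) x * X l] (mod r x)"
  using \<open>k \<le> l\<close>
proof (induction l rule: dec_induct)
  case (step l)
  have x_le: "x \<le> s l" using \<open>x \<le> s k\<close> cofinal_belowD(1)[OF cofinal \<open>k \<le> l\<close>] by (rule order_trans)
  note step.IH
  also have "[E (s l) x * X l = E (s l) x * (E (s (Suc l)) (s l) * X (Suc l))] (mod r x)"
    by (rule cong_scalar_left[OF cong_below[OF compatible x_le]])
  also have "[E (s l) x * (E (s (Suc l)) (s l) * X (Suc l)) =
      E (s (Suc l)) x * X (Suc l)] (mod r x)"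
    unfolding mult.assoc[symmetric]
    by (intro cong_scalar_right cong_sym[OF E_cong] x_le cofinal_belowD[OF cofinal]) simp
  finally show ?case .
qed simp

lemma extend_column:
  assumes cofinal: "cofinal_below d s" and unit: "\<And>k. X k dvd 1"
    and step: "\<And>k. [X k = E (s (Suc k)) (s k) * X (Suc k)] (mod r (s k))"
  obtains Y where "column r E d Y" "\<And>x k. x \<le> s k \<Longrightarrow> [Y x = E (s k) x * X k] (mod r x)"
proof -
  define \<kappa> where "\<kappa> x = (LEAST k. x \<le> s k)" for x
  define Y where "Y x = (if x < d then E (s (\<kappa> x)) x * X (\<kappa> x) else 1)" for x
  note s_less = cofinal_belowD(2)[OF cofinal]
  have le_\<kappa>: "x \<le> s (\<kappa> x)" if "x < d" for x
    unfolding \<kappa>_def using cofinal_belowD(3)[OF cofinal that] by (rule LeastI_ex)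
  have Y_cong: "[Y x = E (s k) x * X k] (mod r x)" if "x \<le> s k" for x k
  proof -
    have "x < d" using that s_less le_less_trans by blast
    moreover have "\<kappa> x \<le> k" unfolding \<kappa>_def using that by (rule Least_le)
    ultimately show ?thesis using cong_along_seq[OF cofinal step le_\<kappa>] by (simp add: Y_def)
  qed
  have "Y x dvd 1" if "x < d" for x
    using that E_unit[OF le_\<kappa> s_less] unit by (simp add: Y_def unit_mult)
  moreover have "[Y x = E t x * Y t] (mod r x)" if "t < d" "x \<le> t" for x t
  proof -
    obtain k where t_le: "t \<le> s k" using cofinal_belowD(3)[OF cofinal \<open>t < d\<close>] by blast
    have "[Y x = E (s k) x * X k] (mod r x)" using Y_cong that(2) t_le by simp
    also have "[E (s k) x * X k = E t x * E (s k) t * X k] (mod r x)"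
      by (rule cong_scalar_right[OF E_cong[OF that(2) t_le s_less]])
    also have "[E t x * E (s k) t * X k = E t x * Y t] (mod r x)"
      unfolding mult.assoc
      by (rule cong_scalar_left[OF cong_below[OF cong_sym[OF Y_cong[OF t_le]] that(2)]])
    finally show ?thesis .
  qed
  moreover have "Y d = 1" by (simp add: Y_def)
  ultimately have "column r E d Y" by (simp add: column_def thread_on_def)
  then show ?thesis using that Y_cong by blast
qed

lemma column_exists:
  assumes "omega1_like TYPE('i)" shows "\<exists>Y. column r E d Y"
proof (cases "\<exists>c. c < d")
  case False
  then have "column r E d (\<lambda>_. 1)" by (auto simp: column_def thread_on_def)
  then show ?thesis by blast
next
  case True
  then obtain s where cofinal: "cofinal_below d s" using omega1_cofinal_below[OF assms] by blast
  define X where "X = rec_nat 1 (\<lambda>k x. unit_inverse (E (s (Suc k)) (s k)) * x)"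
  have X_rec: "X 0 = 1" "X (Suc k) = unit_inverse (E (s (Suc k)) (s k)) * X k" for k
    by (simp_all add: X_def)
  have unit: "E (s (Suc k)) (s k) dvd 1" for k
    by (intro E_unit cofinal_belowD[OF cofinal]) simp
  have "X k dvd 1" for k
    by (induction k) (simp_all add: X_rec unit_mult unit_unit_inverse unit)
  moreover have "[X k = E (s (Suc k)) (s k) * X (Suc k)] (mod r (s k))" for k
    by (simp add: X_rec mult_unit_inverse_cancel unit)
  ultimately show ?thesis using extend_column[OF cofinal] by blast
qed

end

section \<open>Uncountable quotients\<close>

definition twist :: "(nat \<Rightarrow> 'a::comm_ring_1) \<Rightarrow> nat set \<Rightarrow> nat \<Rightarrow> 'a"
  where "twist b A k = (\<Prod>j\<in>A \<inter> {..<k}. 1 + b j)"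

lemma twist_0 [simp]: "twist b A 0 = 1"
  by (simp add: twist_def)

lemma twist_Suc: "twist b A (Suc k) = twist b A k * (if k \<in> A then 1 + b k else 1)"
proof -
  have "A \<inter> {..<Suc k} = (if k \<in> A then insert k (A \<inter> {..<k}) else A \<inter> {..<k})"
    by (auto simp: less_Suc_eq)
  then show ?thesis by (simp add: twist_def mult.commute)
qed

lemma first_difference:
  fixes A B :: "nat set"
  assumes "A \<noteq> B" obtains k where "k \<in> A \<longleftrightarrow> k \<notin> B" "A \<inter> {..<k} = B \<inter> {..<k}"
proof -
  define k where "k = (LEAST k. k \<in> A \<longleftrightarrow> k \<notin> B)"
  have "\<exists>k. k \<in> A \<longleftrightarrow> k \<notin> B" using assms by blast
  then have "k \<in> A \<longleftrightarrow> k \<notin> B" unfolding k_def by (rule LeastI_ex)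
  moreover have "j \<in> A \<longleftrightarrow> j \<in> B" if "j < k" for j
    using not_less_Least[OF that[unfolded k_def]] by blast
  ultimately show ?thesis using that by blast
qed

context valuation_chain
begin

lemma twist_unit: "(\<And>k. r (s k) dvd b k) \<Longrightarrow> twist b A k dvd 1"
  by (induction k) (auto simp: twist_Suc intro: unit_mult one_plus_unit)

lemma one_plus_avoiding_seq:
  fixes s :: "nat \<Rightarrow> 'i"
  assumes uncountable: "\<And>s t. s < t \<Longrightarrow> uncountable (residues (r s) (r t))"
    and "countable N" "strict_mono s"
  obtains b where "\<And>k. r (s k) dvd b k" "\<And>k n n'. n \<in> N \<Longrightarrow> n' \<in> N \<Longrightarrow> n dvd 1 \<Longrightarrow>
    \<not> [n * (1 + b k) = n'] (mod r (s (Suc k)))"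
proof -
  have "uncountable (residues (r (s k)) (r (s (Suc k))))" for k
    using uncountable \<open>strict_mono s\<close> by (simp add: strict_mono_Suc_iff)
  moreover have "countable (N \<times> N)" using \<open>countable N\<close> by simp
  ultimately have "\<not> residues (r (s k)) (r (s (Suc k))) \<lesssim> N \<times> N" for k
    using countable_lepoll by blast
  then have "\<exists>b. r (s k) dvd b \<and>
      (\<forall>n\<in>N. \<forall>n'\<in>N. n dvd 1 \<longrightarrow> \<not> [n * (1 + b) = n'] (mod r (s (Suc k))))" for k
    by (rule one_plus_avoiding) blast
  then show ?thesis using that by metis
qed

definition completable :: "'r set \<Rightarrow> 'i \<Rightarrow> ('i \<Rightarrow> 'r) \<Rightarrow> bool"
  where "completable N d Y \<longleftrightarrow> (\<exists>h. h dvd 1 \<and> (\<forall>s<d. \<exists>n\<in>N. [n = Y s * h] (mod r s)))"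

lemma thread_completable:
  "thread_on r E UNIV v \<Longrightarrow> v ` {..<d} \<subseteq> N \<Longrightarrow> completable N d (E d)"
  unfolding completable_def thread_on_def by (intro exI[of _ "v d"]) (auto intro!: bexI[of _ "v _"])

lemma completions_distinct:
  assumes avoid: "\<And>n n'. n \<in> N \<Longrightarrow> n' \<in> N \<Longrightarrow> n dvd 1 \<Longrightarrow> \<not> [n * (1 + b k) = n'] (mod r s)"
    and diff: "k \<in> A" "k \<notin> B" "A \<inter> {..<k} = B \<inter> {..<k}"
    and "n \<in> N" and n_cong: "[n = y * twist b A (Suc k) * h] (mod r s)"
    and "n' \<in> N" and n'_cong: "[n' = y * twist b B (Suc k) * h'] (mod r s)"
    and unit: "y * twist b B (Suc k) * h' dvd 1"
  shows "h \<noteq> h'"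
proof
  assume "h = h'"
  have "twist b A (Suc k) = twist b B (Suc k) * (1 + b k)"
    using diff by (simp add: twist_Suc) (simp add: twist_def)
  then have "[n = y * twist b B (Suc k) * h' * (1 + b k)] (mod r s)"
    using n_cong by (simp add: \<open>h = h'\<close> mult_ac)
  then have "[n' * (1 + b k) = n] (mod r s)"
    using cong_trans[OF cong_scalar_right[OF n'_cong] cong_sym] by blast
  moreover have "n' dvd 1" using cong_unit[OF cong_sym[OF n'_cong] unit] .
  ultimately show False using avoid[OF \<open>n' \<in> N\<close> \<open>n \<in> N\<close>] by blast
qed

end

context coherent_below
begin

lemma twisted_column:
  assumes cofinal: "cofinal_below d s" and column: "column r E d Y" and dvd_b: "\<And>k. r (s k) dvd b k"
  obtains Y' where "column r E d Y'" "\<And>k. [Y' (s k) = Y (s k) * twist b A k] (mod r (s k))"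
proof -
  define X where "X k = Y (s k) * twist b A k" for k
  note s_less = cofinal_belowD(2)[OF cofinal]
  have unit: "X k dvd 1" for k
    unfolding X_def using column_unit[OF column less_imp_le[OF s_less]] twist_unit[OF dvd_b]
    by (rule unit_mult)
  have step: "[X k = E (s (Suc k)) (s k) * X (Suc k)] (mod r (s k))" for k
  proof -
    have "[Y (s k) = E (s (Suc k)) (s k) * Y (s (Suc k))] (mod r (s k))"
      using column by (rule column_cong) (auto intro: cofinal_belowD[OF cofinal])
    moreover have "[twist b A k = twist b A (Suc k)] (mod r (s k))"
      using dvd_b[of k] by (simp add: twist_Suc cong_def algebra_simps)
    ultimately show ?thesis unfolding X_def mult.assoc[symmetric] by (rule cong_mult)
  qed
  obtain Y' where "column r E d Y'" "\<And>x k. x \<le> s k \<Longrightarrow> [Y' x = E (s k) x * X k] (mod r x)"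
    using extend_column[OF cofinal unit step] by metis
  then show ?thesis using that E_refl[OF s_less] unfolding X_def by (metis mult_1 order_refl)
qed

lemma completable_twists:
  assumes cofinal: "cofinal_below d s" and column: "column r E d Y" and dvd_b: "\<And>k. r (s k) dvd b k"
    and completable: "\<And>Y. column r E d Y \<Longrightarrow> completable N d Y"
  shows "\<exists>h. h dvd 1 \<and> (\<forall>k. \<exists>n\<in>N. [n = Y (s k) * twist b A k * h] (mod r (s k)))"
proof -
  obtain Y' where "column r E d Y'"
    and twisted: "\<And>k. [Y' (s k) = Y (s k) * twist b A k] (mod r (s k))"
    using twisted_column[OF cofinal column dvd_b] by blast
  then have "completable N d Y'" using completable by blast
  then obtain h where unit: "h dvd 1" and completes: "\<forall>x<d. \<exists>n\<in>N. [n = Y' x * h] (mod r x)"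
    unfolding completable_def by (elim exE conjE)
  have "\<exists>n\<in>N. [n = Y (s k) * twist b A k * h] (mod r (s k))" for k
    using completes cofinal_belowD(2)[OF cofinal] cong_trans[OF _ cong_scalar_right[OF twisted]]
    by blast
  then show ?thesis using unit by blast
qed

text \<open>If all columns were completable, the branches \<open>A\<close> of the binary tree would provide continuum
  many twisted columns with pairwise distinct completing elements \<open>h A\<close>.\<close>

lemma incompletable_column_exists:
  assumes omega1: "omega1_like TYPE('i)"
    and uncountable: "\<And>s t. s < t \<Longrightarrow> uncountable (residues (r s) (r t))"
    and small: "\<not> (UNIV :: nat set set) \<lesssim> (UNIV :: 'r set)"
    and "countable N" "is_limit d"
  shows "\<exists>Y. column r E d Y \<and> \<not> completable N d Y"
proof (rule ccontr)
  assume "\<not> ?thesis"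
  then have completable: "completable N d Y" if "column r E d Y" for Y using that by blast
  obtain c where "c < d" using \<open>is_limit d\<close> by (auto simp: is_limit_def)
  then obtain s where cofinal: "cofinal_below d s" and "strict_mono s"
    using omega1_cofinal_below[OF omega1] \<open>is_limit d\<close> by metis
  then obtain b where dvd_b: "\<And>k. r (s k) dvd b k" and avoid: "\<And>k n n'. n \<in> N \<Longrightarrow> n' \<in> N \<Longrightarrow>
      n dvd 1 \<Longrightarrow> \<not> [n * (1 + b k) = n'] (mod r (s (Suc k)))"
    using one_plus_avoiding_seq[OF uncountable \<open>countable N\<close>] by metis
  obtain Y where column: "column r E d Y" using column_exists[OF omega1] by blast
  have "\<exists>h. h dvd 1 \<and> (\<forall>k. \<exists>n\<in>N. [n = Y (s k) * twist b A k * h] (mod r (s k)))" for A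
    by (rule completable_twists[OF cofinal column dvd_b completable])
  then obtain h where h_unit: "\<And>A. h A dvd 1"
    and completes: "\<And>A k. \<exists>n\<in>N. [n = Y (s k) * twist b A k * h A] (mod r (s k))" by metis
  have distinct: "h A \<noteq> h B" if "k \<in> A" "k \<notin> B" "A \<inter> {..<k} = B \<inter> {..<k}" for A B k
  proof -
    obtain n where n_completes: "n \<in> N"
      "[n = Y (s (Suc k)) * twist b A (Suc k) * h A] (mod r (s (Suc k)))"
      using completes by blast
    obtain n' where n'_completes: "n' \<in> N"
      "[n' = Y (s (Suc k)) * twist b B (Suc k) * h B] (mod r (s (Suc k)))"
      using completes by blast
    have "Y (s (Suc k)) * twist b B (Suc k) * h B dvd 1"
      by (intro unit_mult column_unit[OF column] twist_unit[OF dvd_b] h_unit less_imp_le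
          cofinal_belowD(2)[OF cofinal])
    then show ?thesis
      by (rule completions_distinct[OF _ that n_completes n'_completes, rotated]) (rule avoid)
  qed
  have "inj h"
  proof (rule injI, rule ccontr)
    fix A B assume "h A = h B" "A \<noteq> B"
    from \<open>A \<noteq> B\<close> obtain k where "k \<in> A \<longleftrightarrow> k \<notin> B" "A \<inter> {..<k} = B \<inter> {..<k}" by (rule first_difference)
    then show False using distinct[of k A B] distinct[of k B A] \<open>h A = h B\<close> by auto
  qed
  then show False using small unfolding lepoll_def by blast
qed

end

theorem (in valuation_chain) threadless_coherent_units_uncountable:
  assumes omega1: "omega1_like TYPE('i)"
    and uncountable: "\<And>s t. s < t \<Longrightarrow> uncountable (residues (r s) (r t))"
    and small: "\<not> (UNIV :: nat set set) \<lesssim> (UNIV :: 'r set)"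
    and card: "(UNIV :: 'r set) \<lesssim> (UNIV :: 'i set)"
  shows "\<exists>E. coherent_units r E \<and> (\<nexists>v. thread_on r E UNIV v)"
proof -
  obtain \<phi> :: "'r \<Rightarrow> 'i" where "inj \<phi>" using card unfolding lepoll_def by blast
  define N where "N d = \<phi> -` {..<d}" for d
  have countable_N: "countable (N d)" for d
    using countable_image_inj_Int_vimage[OF \<open>inj \<phi>\<close>, of "{..<d}"] omega1
    by (simp add: N_def omega1_like_def lessThan_def)
  have "\<exists>E. \<forall>d. column r E d (E d) \<and> (is_limit d \<longrightarrow> \<not> completable (N d) d (E d))"
  proof (rule dependent_wellorder_choice)
    show "column r E d Y \<and> (is_limit d \<longrightarrow> \<not> completable (N d) d Y) \<longleftrightarrow>
        column r E' d Y \<and> (is_limit d \<longrightarrow> \<not> completable (N d) d Y)"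
      if "\<And>t. t < d \<Longrightarrow> E t = E' t" for E E' d Y
      using column_local[OF that] by simp
    fix d E
    assume "\<And>t. t < d \<Longrightarrow> column r E t (E t) \<and> (is_limit t \<longrightarrow> \<not> completable (N t) t (E t))"
    then interpret coherent_below r E d by unfold_locales blast
    show "\<exists>Y. column r E d Y \<and> (is_limit d \<longrightarrow> \<not> completable (N d) d Y)"
      using incompletable_column_exists[OF omega1 uncountable small countable_N]
        column_exists[OF omega1] by blast
  qed
  then obtain E where column: "\<And>d. column r E d (E d)"
    and incompletable: "\<And>d. is_limit d \<Longrightarrow> \<not> completable (N d) d (E d)" by blast
  have "\<not> thread_on r E UNIV v" for v
  proof
    assume "thread_on r E UNIV v"
    moreover obtain d where "is_limit d" "\<And>s. s < d \<Longrightarrow> \<phi> (v s) < d"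
      using omega1_closure_point[OF omega1, of "\<lambda>s. \<phi> (v s)"] by blast
    ultimately show False
      using incompletable thread_completable[of E v d "N d"] by (auto simp: N_def)
  qed
  moreover have "coherent_units r E" by unfold_locales (rule column)
  ultimately show ?thesis by blast
qed

section \<open>Countable quotients\<close>

lemma ex_between_finite:
  fixes a :: "'a::{dense_linorder, no_top}"
  assumes "finite Q" "\<And>q. q \<in> Q \<Longrightarrow> a < q"
  shows "\<exists>v>a. \<forall>q\<in>Q. v < q"
proof (cases "Q = {}")
  case False
  then have "a < Min Q" using assms by simp
  then obtain v where "a < v" "v < Min Q" using dense by blast
  then show ?thesis using assms False by (intro exI[of _ v]) simp
qed (simp add: gt_ex)

lemma generic_sequence_exists:
  assumes "countable C" "C \<noteq> {}" "P a"
    and dense: "\<And>c x. c \<in> C \<Longrightarrow> P x \<Longrightarrow> \<exists>y. P y \<and> R x y \<and> D c y"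
  obtains x :: "nat \<Rightarrow> 'a" where "\<And>n. P (x n)" "\<And>n. R (x n) (x (Suc n))" "\<And>c. c \<in> C \<Longrightarrow> \<exists>n. D c (x n)"
proof -
  have "\<exists>x. \<forall>n. P (x n) \<and> R (x n) (x (Suc n)) \<and> D (from_nat_into C n) (x (Suc n))"
    using assms(3) dense[OF from_nat_into[OF assms(2)]] by (intro dependent_nat_choice) blast+
  then obtain x where x_seq: "\<And>n. P (x n)" "\<And>n. R (x n) (x (Suc n))"
    "\<And>n. D (from_nat_into C n) (x (Suc n))" by metis
  have "\<exists>n. D c (x n)" if "c \<in> C" for c
    using from_nat_into_surj[OF assms(1) that] x_seq(3) by metis
  then show ?thesis using that x_seq by blast
qed

context valuation_chain
begin

definition principal_units :: "'r set"  ("\<W>")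
  where "\<W> = {u. [u = 1] (mod r bottom)}"

lemma one_in_principal_units [simp]: "1 \<in> \<W>"
  by (simp add: principal_units_def)

lemma principal_units_mult: "u \<in> \<W> \<Longrightarrow> v \<in> \<W> \<Longrightarrow> u * v \<in> \<W>"
  unfolding principal_units_def using cong_mult[of u 1 _ v 1] by simp

lemma principal_units_unit: "u \<in> \<W> \<Longrightarrow> u dvd 1"
  unfolding principal_units_def using cong_unit[OF cong_sym] by auto

lemma cong_bottom: "[u = v] (mod r s) \<Longrightarrow> [u = v] (mod r bottom)"
  by (rule cong_below) (simp_all add: Least_le)

lemma principal_units_cong: "[u = v] (mod r s) \<Longrightarrow> u \<in> \<W> \<longleftrightarrow> v \<in> \<W>"
  unfolding principal_units_def using cong_cong_iff[OF cong_bottom cong_refl] by auto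

lemma principal_units_inverse: assumes "u \<in> \<W>" shows "unit_inverse u \<in> \<W>"
proof -
  have "[u * unit_inverse u = 1 * unit_inverse u] (mod r bottom)"
    using assms unfolding principal_units_def by (intro cong_scalar_right) simp
  then show ?thesis
    using cong_sym
    by (simp add: principal_units_def mult_unit_inverse principal_units_unit[OF assms])
qed

definition translates_below :: "('r \<Rightarrow> rat) \<Rightarrow> 'r \<Rightarrow> ('r \<times> rat) set \<Rightarrow> bool"
  where "translates_below \<phi> x L \<longleftrightarrow> finite L \<and> L \<subseteq> \<W> \<times> UNIV \<and> (\<forall>(h, q)\<in>L. \<phi> (h * x) < q)"

lemma translates_belowD:
  assumes "translates_below \<phi> x L"
  shows "finite L" "(h, q) \<in> L \<Longrightarrow> h \<in> \<W>" "(h, q) \<in> L \<Longrightarrow> \<phi> (h * x) < q"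
  using assms by (auto simp: translates_below_def)

text \<open>The tree has the elements of \<open>\<W>\<close> modulo \<open>r\<^sub>d R\<close> as its nodes of level \<open>d\<close>, and a node \<open>h\<close> of
  level \<open>d\<close> lies above the node \<open>h * Y s\<close> of level \<open>s\<close>. The labels \<open>f s\<close> and \<open>\<phi>\<close> are strictly
  increasing along the tree; the last clause, which keeps the recursion going at limits, says that
  finitely many translates of a node can be extended simultaneously with small increase of the
  labels.\<close>

definition special_column ::
  "('i \<Rightarrow> 'i \<Rightarrow> 'r) \<Rightarrow> ('i \<Rightarrow> 'r \<Rightarrow> rat) \<Rightarrow> 'i \<Rightarrow> ('i \<Rightarrow> 'r) \<Rightarrow> ('r \<Rightarrow> rat) \<Rightarrow> bool"
  where "special_column E f d Y \<phi> \<longleftrightarrow> column r E d Y \<and> (\<forall>s<d. Y s \<in> \<W>)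
    \<and> (\<forall>u v. [u = v] (mod r d) \<longrightarrow> \<phi> u = \<phi> v)
    \<and> (\<forall>s<d. \<forall>h\<in>\<W>. f s (h * Y s) < \<phi> h)
    \<and> (\<forall>s<d. \<forall>x\<in>\<W>. \<forall>L. translates_below (f s) x L \<longrightarrow>
        (\<exists>y\<in>\<W>. [y * Y s = x] (mod r s) \<and> translates_below \<phi> y L))"

lemma special_column_local:
  assumes "\<And>t. t < d \<Longrightarrow> E t = E' t" "\<And>t. t < d \<Longrightarrow> f t = f' t"
  shows "special_column E f d Y \<phi> \<longleftrightarrow> special_column E' f' d Y \<phi>"
  using assms column_local[of d E E' r Y] by (simp add: special_column_def)

end

locale special_below = valuation_chain r for r :: "'i::wellorder \<Rightarrow> 'r::idom" +
  fixes E :: "'i \<Rightarrow> 'i \<Rightarrow> 'r" and f :: "'i \<Rightarrow> 'r \<Rightarrow> rat" and d :: 'i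
  assumes special: "t < d \<Longrightarrow> special_column E f t (E t) (f t)"
    and countable_below: "countable {t. t < d}"
    and countable_residues: "countable (residues (r bottom) (r d))"
    and infinite_residues: "s < d \<Longrightarrow> infinite (residues (r s) (r d))"
begin

sublocale coherent_below r E d
  by unfold_locales (use special in \<open>simp add: special_column_def\<close>)

lemma E_principal: "s \<le> t \<Longrightarrow> t < d \<Longrightarrow> E t s \<in> \<W>"
  using special[of t] E_refl[of t] by (cases "s = t") (auto simp: special_column_def)

lemma f_cong: "t < d \<Longrightarrow> [u = v] (mod r t) \<Longrightarrow> f t u = f t v"
  using special[of t] by (simp add: special_column_def)

lemma f_mono: "s \<le> t \<Longrightarrow> t < d \<Longrightarrow> h \<in> \<W> \<Longrightarrow> f s (h * E t s) \<le> f t h"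
  using special[of t] E_refl[of t]
  by (cases "s = t") (auto simp: special_column_def intro: less_imp_le)

lemma f_extension:
  assumes "s \<le> t" "t < d" "x \<in> \<W>" "translates_below (f s) x L"
  shows "\<exists>y\<in>\<W>. [y * E t s = x] (mod r s) \<and> translates_below (f t) y L"
proof (cases "s = t")
  case True
  then show ?thesis using assms E_refl by (intro bexI[of _ x]) auto
qed (use assms special[of t] in \<open>auto simp: special_column_def\<close>)

abbreviation node :: "'r \<Rightarrow> 'r"
  where "node \<equiv> residue (r d)"

lemma node_principal: "u \<in> \<W> \<Longrightarrow> node u \<in> \<W>"
  using principal_units_cong[OF cong_residue] by blast

lemma cong_node: "s < d \<Longrightarrow> [node u = u] (mod r s)"
  using cong_below[OF cong_residue] by simp

lemma countable_nodes: "countable (node ` \<W>)"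
proof -
  let ?N = "(\<lambda>c. node (1 + c)) ` residues (r bottom) (r d)"
  have "node u \<in> ?N" if "u \<in> \<W>" for u
  proof -
    have "[1 + (u - 1) = 1 + node (u - 1)] (mod r d)"
      by (intro cong_add cong_refl cong_sym[OF cong_residue])
    then have "[u = 1 + node (u - 1)] (mod r d)" by simp
    moreover have "node (u - 1) \<in> residues (r bottom) (r d)"
      using that by (auto simp: residues_def principal_units_def cong_def)
    ultimately show ?thesis using residue_eq_iff by blast
  qed
  then have "node ` \<W> \<subseteq> ?N" by blast
  then show ?thesis using countable_residues countable_image countable_subset by blast
qed

text \<open>A condition fixes the new column at the level \<open>s\<close> and promises finitely many of the new
  labels; column and labels are read off a sufficiently generic sequence of conditions.\<close>

definition condition :: "'i \<Rightarrow> 'r \<Rightarrow> ('r \<rightharpoonup> rat) \<Rightarrow> bool"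
  where "condition s X p \<longleftrightarrow> s < d \<and> X \<in> \<W> \<and> translates_below (f s) X (Map.graph p)"

lemma condition_advance:
  assumes "condition s X p" "s \<le> s'" "s' < d"
  shows "\<exists>X'. condition s' X' p \<and> [X = E s' s * X'] (mod r s)"
proof -
  obtain X' where X'_lift: "X' \<in> \<W>" "[X' * E s' s = X] (mod r s)"
    "translates_below (f s') X' (Map.graph p)"
    using f_extension[OF assms(2,3)] assms(1) unfolding condition_def by blast
  then have "[X = E s' s * X'] (mod r s)" using cong_sym by (simp add: mult.commute)
  then show ?thesis using X'_lift assms(3) by (auto simp: condition_def)
qed

lemma condition_promise_below:
  assumes cond: "condition s X p" and M_below: "translates_below (f s) X M"
    and new: "fst ` M \<inter> dom p = {}"
  shows "\<exists>p'. condition s X p' \<and> p \<subseteq>\<^sub>m p' \<and> (\<forall>(g, q)\<in>M. \<exists>v<q. p' g = Some v)"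
proof -
  have "\<exists>v>f s (g * X). \<forall>q\<in>{q. (g, q) \<in> M}. v < q" for g
  proof (rule ex_between_finite)
    have "{q. (g, q) \<in> M} \<subseteq> snd ` M" by force
    then show "finite {q. (g, q) \<in> M}"
      using M_below finite_subset by (auto simp: translates_below_def)
  qed (use M_below in \<open>auto simp: translates_below_def\<close>)
  then obtain v where v_between: "\<And>g. f s (g * X) < v g" "\<And>g q. (g, q) \<in> M \<Longrightarrow> v g < q" by simp metis
  define p' where "p' g = (if g \<in> fst ` M then Some (v g) else p g)" for g
  have "Map.graph p' \<subseteq> Map.graph p \<union> (\<lambda>g. (g, v g)) ` fst ` M"
    by (auto simp: Map.graph_def p'_def split: if_splits)
  moreover have "finite (Map.graph p \<union> (\<lambda>g. (g, v g)) ` fst ` M)"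
    using cond M_below by (auto simp: condition_def translates_below_def)
  ultimately have "finite (Map.graph p')" by (rule finite_subset)
  moreover have "g \<in> \<W> \<and> f s (g * X) < w" if "p' g = Some w" for g w
  proof (cases "g \<in> fst ` M")
    case True
    then show ?thesis
      using that v_between(1) translates_belowD(2)[OF M_below] by (auto simp: p'_def)
  next
    case False
    then have "(g, w) \<in> Map.graph p" using that by (simp add: p'_def Map.graph_def)
    then show ?thesis using cond translates_belowD(2,3) by (auto simp: condition_def)
  qed
  ultimately have "condition s X p'"
    using cond unfolding condition_def translates_below_def by (auto simp: Map.graph_def)
  moreover have "p \<subseteq>\<^sub>m p'" using new by (auto simp: map_le_def p'_def)
  moreover have "\<forall>(g, q)\<in>M. \<exists>v<q. p' g = Some v" using v_between(2) by (force simp: p'_def)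
  ultimately show ?thesis by blast
qed

lemma condition_promise:
  assumes cond: "condition s X p" and "g \<in> \<W>"
  shows "\<exists>p'. condition s X p' \<and> p \<subseteq>\<^sub>m p' \<and> g \<in> dom p'"
proof (cases "g \<in> dom p")
  case False
  moreover have "translates_below (f s) X {(g, f s (g * X) + 1)}"
    using assms(2) by (simp add: translates_below_def)
  ultimately show ?thesis using condition_promise_below[OF cond] by fastforce
qed (use cond in auto)

lemma ex_unpromised:
  assumes cond: "condition s X p" and u_principal: "u \<in> \<W>" and H_finite: "finite H" "H \<subseteq> \<W>"
  obtains b where "r s dvd b" "\<And>h. h \<in> H \<Longrightarrow> node (h * (u * (1 + b))) \<notin> dom p"
proof -
  have "finite (dom p)"
    using cond by (auto simp: condition_def translates_below_def simp flip: fst_graph_eq_dom)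
  then have "finite ((\<lambda>h. h * u) ` H \<times> dom p)" using H_finite by simp
  moreover have "infinite (residues (r s) (r d))"
    using cond infinite_residues by (simp add: condition_def)
  ultimately have "\<not> residues (r s) (r d) \<lesssim> (\<lambda>h. h * u) ` H \<times> dom p"
    by (meson finite_surj lepoll_iff)
  then obtain b where b_avoids: "r s dvd b" "\<And>m n. m \<in> (\<lambda>h. h * u) ` H \<Longrightarrow> n \<in> dom p \<Longrightarrow> m dvd 1 \<Longrightarrow>
      \<not> [m * (1 + b) = n] (mod r d)"
    by (rule one_plus_avoiding) (rule that)
  have "node (h * (u * (1 + b))) \<notin> dom p" if "h \<in> H" for h
  proof
    assume "node (h * (u * (1 + b))) \<in> dom p"
    moreover have "h * u dvd 1"
      using that H_finite(2) u_principal principal_units_unit unit_mult by blast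
    ultimately have "\<not> [h * u * (1 + b) = node (h * (u * (1 + b)))] (mod r d)"
      using b_avoids(2) that by blast
    then show False by (simp add: mult.assoc cong_sym[OF cong_residue])
  qed
  then show ?thesis using that b_avoids(1) by blast
qed

lemma ex_unpromised_lift:
  assumes cond: "condition s X p"
    and t_le_s: "t \<le> s" and x_principal: "x \<in> \<W>" and L_below: "translates_below (f t) x L"
  obtains y where "y \<in> \<W>" "[y * (E s t * X) = x] (mod r t)"
    "translates_below (f s) X ((\<lambda>(h, q). (node (h * y), q)) ` L)"
    "\<And>h q. (h, q) \<in> L \<Longrightarrow> node (h * y) \<notin> dom p"
proof -
  have s_less: "s < d" and X_principal: "X \<in> \<W>" using cond by (auto simp: condition_def)
  obtain z where z_lift: "z \<in> \<W>" "[z * E s t = x] (mod r t)" "translates_below (f s) z L"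
    using f_extension[OF t_le_s s_less x_principal L_below] by blast
  have heads_principal: "finite (fst ` L)" "fst ` L \<subseteq> \<W>"
    using L_below by (auto simp: translates_below_def)
  have "z * unit_inverse X \<in> \<W>"
    by (intro principal_units_mult principal_units_inverse z_lift X_principal)
  then obtain b where dvd_b: "r s dvd b"
    and fresh: "\<And>h. h \<in> fst ` L \<Longrightarrow> node (h * (z * unit_inverse X * (1 + b))) \<notin> dom p"
    using ex_unpromised[OF cond _ heads_principal] by blast
  define y where "y = z * unit_inverse X * (1 + b)"
  have "1 + b \<in> \<W>" using dvd_b by (subst principal_units_cong[of _ 1 s]) (simp_all add: cong_def)
  then have y_principal: "y \<in> \<W>"
    unfolding y_def by (intro principal_units_mult principal_units_inverse z_lift X_principal)
  have "y * X = X * (unit_inverse X * (z * (1 + b)))" by (simp add: y_def mult_ac)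
  also have "\<dots> = z + z * b"
    using X_principal by (simp add: mult_unit_inverse_cancel principal_units_unit distrib_left)
  finally have yX_cong: "[y * X = z] (mod r s)" using dvd_b by (simp add: cong_def)
  have "[y * X * E s t = x] (mod r t)"
    using cong_scalar_right[OF cong_below[OF yX_cong t_le_s]] z_lift(2) by (rule cong_trans)
  then have lift: "[y * (E s t * X) = x] (mod r t)" by (simp add: mult_ac)
  have "f s (node (h * y) * X) = f s (h * z)" for h
  proof (rule f_cong[OF s_less])
    have "[node (h * y) * X = h * y * X] (mod r s)"
      by (rule cong_scalar_right[OF cong_node[OF s_less]])
    also have "[h * y * X = h * z] (mod r s)"
      unfolding mult.assoc by (rule cong_scalar_left[OF yX_cong])
    finally show "[node (h * y) * X = h * z] (mod r s)" .
  qed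
  then have "translates_below (f s) X ((\<lambda>(h, q). (node (h * y), q)) ` L)"
    using z_lift(3) y_principal
    by (auto simp: translates_below_def intro!: node_principal principal_units_mult)
  then show ?thesis using that y_principal lift fresh unfolding y_def by force
qed

definition realised :: "'i \<Rightarrow> 'r \<Rightarrow> ('r \<times> rat) set \<Rightarrow> 'i \<Rightarrow> 'r \<Rightarrow> ('r \<rightharpoonup> rat) \<Rightarrow> bool"
  where "realised t x L s X p \<longleftrightarrow> (\<exists>y\<in>\<W>. [y * (E s t * X) = x] (mod r t) \<and>
    (\<forall>(h, q)\<in>L. \<exists>v<q. p (node (h * y)) = Some v))"

lemma condition_realise:
  assumes cond: "condition s X p" and "t \<le> s" "x \<in> \<W>" "translates_below (f t) x L"
  shows "\<exists>p'. condition s X p' \<and> p \<subseteq>\<^sub>m p' \<and> realised t x L s X p'"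
proof -
  obtain y where y_lift: "y \<in> \<W>" "[y * (E s t * X) = x] (mod r t)"
    and M_below: "translates_below (f s) X ((\<lambda>(h, q). (node (h * y), q)) ` L)"
    and new: "\<And>h q. (h, q) \<in> L \<Longrightarrow> node (h * y) \<notin> dom p"
    by (rule ex_unpromised_lift[OF assms]) (rule that)
  have "fst ` (\<lambda>(h, q). (node (h * y), q)) ` L \<inter> dom p = {}" using new by force
  then obtain p' where "condition s X p'" "p \<subseteq>\<^sub>m p'"
    "\<forall>(g, q)\<in>(\<lambda>(h, q). (node (h * y), q)) ` L. \<exists>v<q. p' g = Some v"
    using condition_promise_below[OF cond M_below] by blast
  then show ?thesis using y_lift unfolding realised_def by (intro exI[of _ p']) auto
qed

definition tasks :: "('i \<times> 'r \<times> ('r \<times> rat) set \<times> 'r) set"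
  where "tasks = {t. t < d} \<times> node ` \<W> \<times> {L. finite L \<and> L \<subseteq> node ` \<W> \<times> UNIV} \<times> node ` \<W>"

fun accomplished :: "'i \<times> 'r \<times> ('r \<times> rat) set \<times> 'r \<Rightarrow> 'i \<times> 'r \<times> ('r \<rightharpoonup> rat) \<Rightarrow> bool"
  where "accomplished (t, x, L, g) (s, X, p) \<longleftrightarrow>
    t \<le> s \<and> g \<in> dom p \<and> (translates_below (f t) x L \<longrightarrow> realised t x L s X p)"

lemma countable_tasks: "countable tasks"
  unfolding tasks_def
  by (intro countable_SIGMA countable_Collect_finite_subset countable_nodes countable_below
      countableI_type)

lemma condition_accomplish:
  assumes task: "(t, x, L, g) \<in> tasks" and cond: "condition s X p"
  shows "\<exists>s' X' p'. condition s' X' p' \<and> s \<le> s' \<and> [X = E s' s * X'] (mod r s) \<and> p \<subseteq>\<^sub>m p' \<and>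
    accomplished (t, x, L, g) (s', X', p')"
proof -
  have t_less: "t < d" and x_principal: "x \<in> \<W>" and g_principal: "g \<in> \<W>"
    using task node_principal by (auto simp: tasks_def)
  define s' where "s' = max s t"
  have s'_bounds: "s \<le> s'" "t \<le> s'" "s' < d" using t_less cond by (auto simp: s'_def condition_def)
  obtain X' where X'_advance: "condition s' X' p" "[X = E s' s * X'] (mod r s)"
    using condition_advance[OF cond s'_bounds(1,3)] by blast
  obtain p\<^sub>1 where promise: "condition s' X' p\<^sub>1" "p \<subseteq>\<^sub>m p\<^sub>1" "g \<in> dom p\<^sub>1"
    using condition_promise[OF X'_advance(1) g_principal] by blast
  obtain p\<^sub>2 where realise: "condition s' X' p\<^sub>2" "p\<^sub>1 \<subseteq>\<^sub>m p\<^sub>2"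
    "translates_below (f t) x L \<longrightarrow> realised t x L s' X' p\<^sub>2"
    using condition_realise[OF promise(1) s'_bounds(2) x_principal] promise(1) map_le_refl by blast
  have "g \<in> dom p\<^sub>2" using promise(3) realise(2) map_le_implies_dom_le by blast
  moreover have "p \<subseteq>\<^sub>m p\<^sub>2" using promise(2) realise(2) by (rule map_le_trans)
  ultimately show ?thesis using realise X'_advance(2) s'_bounds by auto
qed

end

locale generic_conditions = special_below r E f d
  for r :: "'i::wellorder \<Rightarrow> 'r::idom" and E f d +
  fixes S :: "nat \<Rightarrow> 'i" and X :: "nat \<Rightarrow> 'r" and p :: "nat \<Rightarrow> 'r \<rightharpoonup> rat"
  assumes cond: "condition (S n) (X n) (p n)"
    and S_Suc: "S n \<le> S (Suc n)"
    and X_Suc: "[X n = E (S (Suc n)) (S n) * X (Suc n)] (mod r (S n))"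
    and p_Suc: "p n \<subseteq>\<^sub>m p (Suc n)"
    and generic: "c \<in> tasks \<Longrightarrow> \<exists>n. accomplished c (S n, X n, p n)"
begin

lemma S_less: "S n < d" and X_principal: "X n \<in> \<W>"
  using cond by (auto simp: condition_def)

lemma cofinal_S: "cofinal_below d S"
proof -
  have "\<exists>n. x \<le> S n" if "x < d" for x
    using generic[of "(x, node 1, {}, node 1)"] that by (auto simp: tasks_def)
  then show ?thesis using S_less S_Suc by (simp add: cofinal_below_def mono_iff_le_Suc)
qed

definition label :: "'r \<Rightarrow> rat"
  where "label u = (THE v. \<exists>n. p n (node u) = Some v)"

lemma label_eq: assumes "p n (node u) = Some v" shows "label u = v"
proof -
  have mono: "p m \<subseteq>\<^sub>m p n" if "m \<le> n" for m n
    using that by (induction n rule: dec_induct) (auto intro: p_Suc map_le_trans)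
  have "w = v" if "p m (node u) = Some w" for m w
  proof -
    have "p (max m n) (node u) = Some w" "p (max m n) (node u) = Some v"
      using mono[of m "max m n"] mono[of n "max m n"] that assms
      by (auto simp: map_le_def) (metis domI)+
    then show ?thesis by simp
  qed
  then show ?thesis unfolding label_def using assms by blast
qed

lemma label_increasing:
  assumes Y_cong: "\<And>x k. x \<le> S k \<Longrightarrow> [Y x = E (S k) x * X k] (mod r x)"
    and s_less: "s < d" and h_principal: "h \<in> \<W>"
  shows "f s (h * Y s) < label h"
proof -
  obtain n where stage_n: "s \<le> S n" "node h \<in> dom (p n)"
    using generic[of "(s, node 1, {}, node h)"] s_less h_principal by (auto simp: tasks_def)
  then obtain v where promise_v: "p n (node h) = Some v" by blast
  have "[h * Y s = node h * X n * E (S n) s] (mod r s)"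
    using cong_mult[OF cong_sym[OF cong_node[OF s_less, of h]] Y_cong[OF stage_n(1)]]
    by (simp add: mult_ac)
  then have "f s (h * Y s) = f s (node h * X n * E (S n) s)" by (rule f_cong[OF s_less])
  also have "\<dots> \<le> f (S n) (node h * X n)"
    by (intro f_mono stage_n(1) S_less principal_units_mult node_principal h_principal X_principal)
  also have "\<dots> < v"
    using cond[of n] promise_v by (auto simp: condition_def translates_below_def Map.graph_def)
  also have "v = label h" using label_eq[OF promise_v] by simp
  finally show ?thesis .
qed

lemma label_extension:
  assumes Y_cong: "\<And>x k. x \<le> S k \<Longrightarrow> [Y x = E (S k) x * X k] (mod r x)"
    and s_less: "s < d" and x_principal: "x \<in> \<W>" and L_below: "translates_below (f s) x L"
  shows "\<exists>y\<in>\<W>. [y * Y s = x] (mod r s) \<and> translates_below label y L"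
proof -
  define L' where "L' = (\<lambda>(h, q). (node h, q)) ` L"
  have "(s, node x, L', node 1) \<in> tasks"
    using s_less x_principal L_below by (auto simp: tasks_def L'_def translates_below_def)
  then obtain n where stage_n: "accomplished (s, node x, L', node 1) (S n, X n, p n)"
    using generic by blast
  have "f s (node h * node x) = f s (h * x)" for h
    by (intro f_cong[OF s_less] cong_mult cong_node s_less)
  then have "translates_below (f s) (node x) L'"
    using L_below node_principal by (auto simp: L'_def translates_below_def)
  then have "s \<le> S n" and "realised s (node x) L' (S n) (X n) (p n)" using stage_n by simp_all
  then obtain y where y_lift: "y \<in> \<W>" "[y * (E (S n) s * X n) = node x] (mod r s)"
    and promised: "\<forall>(h, q)\<in>L'. \<exists>v<q. p n (node (h * y)) = Some v"
    unfolding realised_def by blast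
  have "label (h * y) < q" if "(h, q) \<in> L" for h q
  proof -
    have "(node h, q) \<in> L'" using that by (force simp: L'_def)
    then obtain v where "p n (node (node h * y)) = Some v" "v < q" using promised by blast
    moreover have "node (node h * y) = node (h * y)"
      unfolding residue_eq_iff by (rule cong_scalar_right[OF cong_residue])
    ultimately show ?thesis using label_eq by metis
  qed
  then have "translates_below label y L" using L_below by (auto simp: translates_below_def)
  moreover have "[y * Y s = x] (mod r s)"
    using cong_scalar_left[OF Y_cong[OF \<open>s \<le> S n\<close>]] cong_trans[OF y_lift(2) cong_node[OF s_less]]
    by (rule cong_trans)
  ultimately show ?thesis using y_lift(1) by blast
qed

lemma special_column_label: "\<exists>Y. special_column E f d Y label"
proof -
  obtain Y where column: "column r E d Y"
    and Y_cong: "\<And>x k. x \<le> S k \<Longrightarrow> [Y x = E (S k) x * X k] (mod r x)"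
    using extend_column[OF cofinal_S principal_units_unit[OF X_principal] X_Suc] by blast
  have "Y s \<in> \<W>" if "s < d" for s
  proof -
    obtain k where s_le_S: "s \<le> S k" using cofinal_belowD(3)[OF cofinal_S \<open>s < d\<close>] by blast
    then show ?thesis
      using principal_units_cong[OF Y_cong[OF s_le_S]]
        principal_units_mult[OF E_principal[OF s_le_S S_less] X_principal]
      by blast
  qed
  moreover have "label u = label v" if "[u = v] (mod r d)" for u v
    using that by (simp add: label_def flip: residue_eq_iff)
  ultimately have "special_column E f d Y label"
    using column label_increasing[OF Y_cong] label_extension[OF Y_cong]
    by (simp add: special_column_def)
  then show ?thesis by blast
qed

end

context valuation_chain
begin

lemma special_column_exists:
  assumes omega1: "omega1_like TYPE('i)"
    and countable: "countable (residues (r bottom) (r d))"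
    and infinite: "\<And>s. s < d \<Longrightarrow> infinite (residues (r s) (r d))"
    and special: "\<And>t. t < d \<Longrightarrow> special_column E f t (E t) (f t)"
  shows "\<exists>Y \<phi>. special_column E f d Y \<phi>"
proof (cases "\<exists>c. c < d")
  case False
  then have "special_column E f d (\<lambda>_. 1) (\<lambda>_. 0)"
    by (auto simp: special_column_def column_def thread_on_def)
  then show ?thesis by blast
next
  case True
  then obtain c where c_less: "c < d" ..
  interpret special_below r E f d
    by unfold_locales (use special countable infinite omega1 in \<open>simp_all add: omega1_like_def\<close>)
  let ?cond = "\<lambda>(s, X, p). condition s X p"
  let ?ext = "\<lambda>(s, X, p) (s', X', p'). s \<le> s' \<and> [X = E s' s * X'] (mod r s) \<and> p \<subseteq>\<^sub>m p'"
  have "(c, node 1, {}, node 1) \<in> tasks" using c_less by (simp add: tasks_def)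
  then have nonempty: "tasks \<noteq> {}" by blast
  have start: "?cond (c, 1, Map.empty)"
    using c_less by (simp add: condition_def translates_below_def)
  have dense: "\<exists>y. ?cond y \<and> ?ext x y \<and> accomplished a y" if "a \<in> tasks" "?cond x" for a x
    using that condition_accomplish by (cases a; cases x) fastforce
  obtain x where x_seq: "\<And>n. ?cond (x n)" "\<And>n. ?ext (x n) (x (Suc n))"
    "\<And>a. a \<in> tasks \<Longrightarrow> \<exists>n. accomplished a (x n)"
    by (rule generic_sequence_exists[where P = ?cond and R = ?ext and D = accomplished,
          OF countable_tasks nonempty start]) (erule (1) dense, rule that)
  interpret generic_conditions r E f d "\<lambda>n. fst (x n)" "\<lambda>n. fst (snd (x n))" "\<lambda>n. snd (snd (x n))"
    using x_seq by unfold_locales (auto simp: case_prod_beta)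
  show ?thesis using special_column_label by blast
qed

lemma normalized_thread_principal:
  assumes "thread_on r E UNIV v" and E_bottom: "\<And>t. E t bottom \<in> \<W>"
  shows "unit_inverse (v bottom) * v t \<in> \<W>"
proof -
  have unit: "v bottom dvd 1" and thread: "[v bottom = E t bottom * v t] (mod r bottom)"
    using assms(1) by (auto simp: thread_on_def Least_le)
  note thread
  also have "[E t bottom * v t = 1 * v t] (mod r bottom)"
    using E_bottom[of t] by (intro cong_scalar_right) (simp add: principal_units_def)
  finally have "[unit_inverse (v bottom) * v bottom = unit_inverse (v bottom) * v t] (mod r bottom)"
    by (intro cong_scalar_left) simp
  then show ?thesis
    using mult_unit_inverse[OF unit] cong_sym by (simp add: principal_units_def mult.commute)
qed

lemma no_thread_of_special_columns:
  assumes omega1: "omega1_like TYPE('i)" and special: "\<And>d. special_column E f d (E d) (f d)"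
  shows "\<not> thread_on r E UNIV v"
proof
  assume thread: "thread_on r E UNIV v"
  define w where "w t = unit_inverse (v bottom) * v t" for t
  have "E t s \<in> \<W>" if "s \<le> t" for s t
    using special[of t] that by (cases "s = t") (auto simp: special_column_def column_def)
  then have w_principal: "w t \<in> \<W>" for t
    unfolding w_def by (intro normalized_thread_principal[OF thread]) (simp add: Least_le)
  have "f s (w s) < f t (w t)" if "s < t" for s t
  proof -
    have "[v s = E t s * v t] (mod r s)" using thread that by (simp add: thread_on_def)
    then have "[w s = w t * E t s] (mod r s)"
      unfolding w_def using cong_scalar_left by (metis mult.assoc mult.commute)
    then have "f s (w s) = f s (w t * E t s)" using special[of s] by (simp add: special_column_def)
    also have "\<dots> < f t (w t)" using special[of t] w_principal that by (simp add: special_column_def)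
    finally show ?thesis .
  qed
  then have "inj (\<lambda>s. f s (w s))" by (intro strict_mono_imp_inj_on strict_monoI)
  then have "countable (UNIV :: 'i set)" by (rule countable_image_inj_on[OF countableI_type])
  then show False using omega1 by (simp add: omega1_like_def)
qed

theorem threadless_coherent_units_countable:
  assumes omega1: "omega1_like TYPE('i)"
    and countable: "\<And>d. countable (residues (r bottom) (r d))"
    and infinite: "\<And>s d. s < d \<Longrightarrow> infinite (residues (r s) (r d))"
  shows "\<exists>E. coherent_units r E \<and> (\<nexists>v. thread_on r E UNIV v)"
proof -
  have "\<exists>G. \<forall>d. special_column (fst \<circ> G) (snd \<circ> G) d (fst (G d)) (snd (G d))"
  proof (rule dependent_wellorder_choice)
    show "special_column (fst \<circ> G) (snd \<circ> G) d (fst c) (snd c) \<longleftrightarrow>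
        special_column (fst \<circ> G') (snd \<circ> G') d (fst c) (snd c)"
      if "\<And>t. t < d \<Longrightarrow> G t = G' t" for G G' d c
      by (rule special_column_local) (simp_all add: that)
    fix d G
    assume "\<And>t. t < d \<Longrightarrow> special_column (fst \<circ> G) (snd \<circ> G) t (fst (G t)) (snd (G t))"
    then show "\<exists>c. special_column (fst \<circ> G) (snd \<circ> G) d (fst c) (snd c)"
      using special_column_exists[OF omega1 countable infinite, of d "fst \<circ> G" "snd \<circ> G"] by simp
  qed
  then obtain G where "\<And>d. special_column (fst \<circ> G) (snd \<circ> G) d (fst (G d)) (snd (G d))" by blast
  then have special: "special_column (fst \<circ> G) (snd \<circ> G) d ((fst \<circ> G) d) ((snd \<circ> G) d)" for d
    by simp
  then have "coherent_units r (fst \<circ> G)" by unfold_locales (simp add: special_column_def)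
  then show ?thesis using no_thread_of_special_columns[OF omega1 special] by blast
qed

end

section \<open>Reduction to the two cases\<close>

lemma cub_greaterThan:
  fixes s :: "'i::wellorder"
  assumes "omega1_like TYPE('i)" shows "cub {s<..}"
  unfolding cub_def
proof (intro conjI allI impI)
  fix a
  obtain b where "\<And>x. x \<in> {a, s} \<Longrightarrow> x < b" by (rule omega1_bounded[OF assms, of "{a, s}"]) auto
  then show "\<exists>c\<in>{s<..}. a < c" by auto
qed (auto simp: is_limit_def intro: less_trans)

lemma quot_complete_of_stable:
  assumes "s < d" and stable: "\<And>t. t < d \<Longrightarrow> r t dvd r s"
  shows "quot_complete r d"
  unfolding quot_complete_def
proof (intro allI impI)
  fix x :: "nat \<Rightarrow> 'b"
  assume "\<forall>s<d. \<exists>N. \<forall>m\<ge>N. \<forall>n\<ge>N. r s dvd x m - x n"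
  then obtain N where "\<forall>m\<ge>N. \<forall>n\<ge>N. r s dvd x m - x n" using assms(1) by blast
  then have "r t dvd x n - x N" if "N \<le> n" "t < d" for t n
    using that stable dvd_trans by blast
  then show "\<exists>y. \<forall>t<d. \<exists>N. \<forall>n\<ge>N. r t dvd x n - y" by blast
qed

lemma stationary_Gamma_unstable:
  fixes r :: "'i::wellorder \<Rightarrow> 'r::idom"
  assumes omega1: "omega1_like TYPE('i)" and dvd_mono: "\<And>s t. s \<le> t \<Longrightarrow> r s dvd r t"
    and Gamma: "stationary (Gamma_set r)"
  shows "\<exists>t>s. \<not> r t dvd r s"
proof (rule ccontr)
  assume "\<not> ?thesis"
  then have "r t dvd r s" for t using dvd_mono by (metis not_le)
  moreover obtain d where "d \<in> Gamma_set r" "s < d"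
    using Gamma cub_greaterThan[OF omega1] unfolding stationary_def by blast
  ultimately show False using quot_complete_of_stable[of s d r] by (simp add: Gamma_set_def)
qed

lemma infinite_residues_eventually:
  fixes r :: "'i::wellorder \<Rightarrow> 'r::idom"
  assumes omega1: "omega1_like TYPE('i)" and dvd_mono: "\<And>s t. s \<le> t \<Longrightarrow> r s dvd r t"
    and unstable: "\<And>s. \<exists>t>s. \<not> r t dvd r s"
  shows "\<exists>t. infinite (residues (r s) (r t))"
proof -
  obtain h where h_unstable: "\<And>s. s < h s" "\<And>s. \<not> r (h s) dvd r s" using unstable by metis
  define a where "a n = (h ^^ n) s" for n
  have a_iterate: "a 0 = s" "a (Suc n) = h (a n)" for n by (simp_all add: a_def)
  obtain t where t_upper: "\<And>x. x \<in> range a \<Longrightarrow> x < t"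
    by (rule omega1_bounded[OF omega1, of "range a"]) auto
  have "infinite (residues (r (a 0)) (r t))"
    by (rule infinite_residues_of_strict_chain)
      (auto simp: a_iterate h_unstable less_imp_le t_upper intro: dvd_mono)
  then show ?thesis by (auto simp: a_iterate)
qed

lemma represents_dvd: "represents r J \<Longrightarrow> s \<le> t \<Longrightarrow> r s dvd r t"
  by (cases "s = t") (auto simp: represents_def)

lemma represents_nonzero: "represents r J \<Longrightarrow> r s \<noteq> 0"
  by (simp add: represents_def)

lemma represents_subchain:
  fixes r :: "'i::wellorder \<Rightarrow> 'r::idom"
  assumes rep: "represents r J" and g_increasing: "strict_mono g" "\<And>s. s \<le> g s"
  shows "represents (r \<circ> g) J"
proof -
  have "invR (r s) \<subseteq> invR (r (g s))" for s
    by (rule invR_mono[OF represents_dvd[OF rep g_increasing(2)] represents_nonzero[OF rep]])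
  then have "(\<Union>s. invR (r s)) = (\<Union>s. invR (r (g s)))" by blast
  then show ?thesis using rep g_increasing(1) by (simp add: represents_def strict_mono_def)
qed

lemma valuation_chain_of_represents:
  fixes r :: "'i::wellorder \<Rightarrow> 'r::idom"
  assumes "valuation_domain TYPE('r)" "represents r J" "\<And>s. \<not> r s dvd 1"
  shows "valuation_chain r"
  by unfold_locales (use assms represents_dvd represents_nonzero in blast)+

lemma thin_out_chain:
  fixes r :: "'i::wellorder \<Rightarrow> 'r::idom"
  assumes omega1: "omega1_like TYPE('i)" and val: "valuation_domain TYPE('r)"
    and rep: "represents r J" and nonunit_n: "\<not> r n dvd 1"
    and large: "\<And>s. \<exists>t. large (residues (r s) (r t))"
    and large_upward: "\<And>A B. large A \<Longrightarrow> A \<lesssim> B \<Longrightarrow> large B"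
  obtains g :: "'i \<Rightarrow> 'i" where "represents (r \<circ> g) J" "valuation_chain (r \<circ> g)"
    "\<And>s t. s < t \<Longrightarrow> large (residues ((r \<circ> g) s) ((r \<circ> g) t))" "\<And>s. n \<le> g s"
proof -
  have mono: "large (residues (r s) (r u))" if "large (residues (r s) (r t))" "t \<le> u" for s t u
    using large_upward[OF that(1) residues_lepoll[OF represents_dvd[OF rep that(2)]]] .
  obtain g :: "'i \<Rightarrow> 'i" where g_subchain: "strict_mono g"
    "\<And>s t. s < t \<Longrightarrow> large (residues (r (g s)) (r (g t)))" "\<And>s. n \<le> g s" "\<And>s. s \<le> g s"
    by (rule omega1_subchain[where Q = "\<lambda>s t. large (residues (r s) (r t))" and n = n,
          OF omega1 large])
      (erule (1) mono, rule that)
  have rep': "represents (r \<circ> g) J" by (rule represents_subchain[OF rep g_subchain(1,4)])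
  have "\<not> r (g s) dvd 1" for s
    using nonunit_n represents_dvd[OF rep g_subchain(3)] dvd_trans by blast
  then have "valuation_chain (r \<circ> g)" by (intro valuation_chain_of_represents[OF val rep']) simp
  then show ?thesis using that rep' g_subchain(2,3) by simp
qed

theorem threadless_coherent_units_exist:
  fixes r :: "'i::wellorder \<Rightarrow> 'r::idom"
  assumes omega1: "omega1_like TYPE('i)" and val: "valuation_domain TYPE('r)"
    and small: "\<not> (UNIV :: nat set set) \<lesssim> (UNIV :: 'r set)"
    and card: "(UNIV :: 'r set) \<lesssim> (UNIV :: 'i set)"
    and rep: "represents r J"
    and Gamma: "stationary (Gamma_set r)"
  shows "\<exists>(r' :: 'i \<Rightarrow> 'r) E. represents r' J \<and> coherent_units r' E \<and> (\<nexists>v. thread_on r' E UNIV v)"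
proof -
  note r_dvd = represents_dvd[OF rep]
  have unstable: "\<exists>t>s. \<not> r t dvd r s" for s
    by (rule stationary_Gamma_unstable[OF omega1 r_dvd Gamma])
  then obtain n where nonunit_n: "\<not> r n dvd 1" by (meson dvd_trans one_dvd)
  show ?thesis
  proof (cases "\<forall>s. \<exists>t. uncountable (residues (r s) (r t))")
    case True
    obtain g :: "'i \<Rightarrow> 'i" where rep': "represents (r \<circ> g) J" and "valuation_chain (r \<circ> g)"
      and uncountable_residues: "\<And>s t. s < t \<Longrightarrow> uncountable (residues ((r \<circ> g) s) ((r \<circ> g) t))"
      by (rule thin_out_chain[OF omega1 val rep nonunit_n, where large = uncountable])
        (use True countable_lepoll in \<open>auto\<close>)
    then interpret valuation_chain "r \<circ> g" by simp
    show ?thesis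
      using threadless_coherent_units_uncountable[OF omega1 uncountable_residues small card] rep'
      by blast
  next
    case False
    then obtain m where countable_m: "\<And>t. countable (residues (r m) (r t))" by blast
    have nonunit: "\<not> r (max m n) dvd 1" using nonunit_n r_dvd[of n "max m n"] dvd_trans by auto
    obtain g :: "'i \<Rightarrow> 'i" where rep': "represents (r \<circ> g) J" and "valuation_chain (r \<circ> g)"
      and infinite_residues: "\<And>s t. s < t \<Longrightarrow> infinite (residues ((r \<circ> g) s) ((r \<circ> g) t))"
      and g_ge: "\<And>s. max m n \<le> g s"
      by (rule thin_out_chain[OF omega1 val rep nonunit,
            OF infinite_residues_eventually[OF omega1 r_dvd unstable]])
        (auto simp: infinite_le_lepoll intro: lepoll_trans)
    then interpret valuation_chain "r \<circ> g" by simp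
    have "countable (residues ((r \<circ> g) bottom) ((r \<circ> g) d))" for d
      using residues_subset[OF r_dvd] g_ge countable_m countable_subset
      by (metis comp_apply max.boundedE)
    then show ?thesis
      using threadless_coherent_units_countable[OF omega1 _ infinite_residues] rep' by blast
  qed
qed

lemma times_lepoll_infinite:
  assumes "infinite B" "A \<lesssim> B" shows "A \<times> B \<lesssim> B"
proof -
  have "A \<times> B \<lesssim> B \<times> B" using assms(2) by (intro times_lepoll_mono) auto
  moreover have "B \<times> B \<lesssim> B"
    using card_of_Times_same_infinite[OF assms(1)] eqpoll_iff_card_of_ordIso eqpoll_imp_lepoll
    by blast
  ultimately show ?thesis by (rule lepoll_trans)
qed

theorem mainTheorem11:
  fixes r :: "'i::wellorder \<Rightarrow> 'r::idom"
    and J :: "'r fract set"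
  assumes omega1: "omega1_like TYPE('i)"
    and notCH: "\<not> ((UNIV :: 'i set) \<approx> (UNIV :: real set))"
    and val: "valuation_domain TYPE('r)"
    and card: "(UNIV :: 'r set) \<approx> (UNIV :: 'i set)"
    and Jsub: "Q_submodule J" and RJ: "Rset \<subseteq> J"
    and rep: "represents r J"
    and Gamma: "stationary (Gamma_set r)"
  shows "\<exists>(M :: 'r set set) add z sm.
           uniserial M add z sm \<and> \<not> standard M add z sm \<and> has_type M add z sm J Rset"
proof -
  have "\<not> (UNIV :: nat set set) \<lesssim> (UNIV :: 'r set)"
    using not_nat_sets_lepoll_omega1[OF omega1 notCH] card lepoll_trans2 by blast
  then obtain r' :: "'i \<Rightarrow> 'r" and E where "represents r' J" "coherent_units r' E"
    and "\<nexists>v. thread_on r' E UNIV v"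
    using threadless_coherent_units_exist[OF omega1 val _ eqpoll_imp_lepoll[OF card] rep Gamma]
    by blast
  moreover have "infinite (UNIV :: 'i set)"
    using omega1 countable_finite by (auto simp: omega1_like_def)
  then have "(UNIV :: ('i \<times> 'r) set) \<lesssim> (UNIV :: 'r set)"
    unfolding UNIV_Times_UNIV[symmetric] using card eqpoll_finite_iff eqpoll_imp_lepoll eqpoll_sym
    by (intro times_lepoll_infinite) blast+
  ultimately show ?thesis by (rule coherent_units.nonstandard_uniserial_exists[rotated -1])
qed

end
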